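(* Let $\Lambda$ be a finite dimensional Auslander algebra over an algebraically closed field $k$, and let $M$ be a $\Lambda$-module. Then $\mathrm{pd}_{\Lambda}\,M\leq 1$ if and only if $\mathrm{pd}_{\Lambda}\,\mathrm{soc}\,M\leq 1$. That is, $$\mathcal{P}^{1}(\Lambda)=\{\,M\in \mathrm{mod}\text{-}\Lambda \mid \mathrm{pd}_{\Lambda}\,\mathrm{soc}\,M\leq 1\,\}.$$
   Context: Standing conventions: $k$ is an algebraically closed field; all algebras are basic finite dimensional $k$-algebras; modules are finitely generated right modules, and $\mathrm{mod}\text{-}\Lambda$ is the category of finitely generated right $\Lambda$-modules. $\mathrm{pd}_\Lambda M$ denotes the projective dimension of $M$ and $\mathrm{soc}\,M$ its socle. A finite dimensional algebra $\Lambda$ is an Auslander algebra if its global dimension is at most two and its dominant dimension is at least two, that is, in the minimal injective resolution $0\to\Lambda\to I_0\to I_1\to I_2\to 0$ of $\Lambda$ (as a right $\Lambda$-module), both $I_0$ and $I_1$ are projective $\Lambda$-modules (terms of the resolution may be zero). $\mathcal{P}^{1}(\Lambda)$ is the full subcategory of $\mathrm{mod}\text{-}\Lambda$ whose objects are all the $\Lambda$-modules $M$ with $\mathrm{pd}_\Lambda M\leq 1$; the displayed equality is an equality of full subcategories (i.e. of classes of objects). *)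

theory Defs
  imports "HOL-Algebra.Algebraic_Closure" "HOL-Library.Extended_Nat"
begin

section \<open>Finite-dimensional algebras\<close>

(* A K-algebra is a record whose ring part is the (not necessarily commutative) ring and whose smult
   is the action of K.  The library locale algebra is not usable here, as it demands commutativity. *)
locale field_algebra = module K A
  for K :: "('k, 'x) ring_scheme" (structure) and A :: "('k, 'a) module" (structure) +
  assumes field: "field K"
    and ring: "ring A"
    and smult_mult_left:
      "\<lbrakk>c \<in> carrier K; x \<in> carrier A; y \<in> carrier A\<rbrakk> \<Longrightarrow>
        c \<odot>\<^bsub>A\<^esub> (x \<otimes>\<^bsub>A\<^esub> y) = (c \<odot>\<^bsub>A\<^esub> x) \<otimes>\<^bsub>A\<^esub> y"
    and smult_mult_right:
      "\<lbrakk>c \<in> carrier K; x \<in> carrier A; y \<in> carrier A\<rbrakk> \<Longrightarrow>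
        c \<odot>\<^bsub>A\<^esub> (x \<otimes>\<^bsub>A\<^esub> y) = x \<otimes>\<^bsub>A\<^esub> (c \<odot>\<^bsub>A\<^esub> y)"

definition generated_submodule ::
    "('a, 'r) ring_scheme \<Rightarrow> ('a, 'm) module \<Rightarrow> 'm set \<Rightarrow> 'm set" where
  "generated_submodule R M U = \<Inter>{N. submodule N R M \<and> U \<subseteq> N}"

definition finitely_generated :: "('a, 'r) ring_scheme \<Rightarrow> ('a, 'm) module \<Rightarrow> bool" where
  "finitely_generated R M \<longleftrightarrow>
     (\<exists>U. finite U \<and> U \<subseteq> carrier M \<and> generated_submodule R M U = carrier M)"

definition finite_dimensional_algebra :: "('k, 'x) ring_scheme \<Rightarrow> ('k, 'a) module \<Rightarrow> bool" where
  "finite_dimensional_algebra K A \<longleftrightarrow> field_algebra K A \<and> finitely_generated K A"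


section \<open>Right modules\<close>

(* The record operation "a \<odot> x" is read as the right action x.a; hence the order in smult_assoc. *)
locale right_module = R?: ring R + M?: abelian_group M
  for R :: "('a, 'r) ring_scheme" (structure) and M :: "('a, 'm) module" (structure) +
  assumes smult_closed:
      "\<lbrakk>a \<in> carrier R; x \<in> carrier M\<rbrakk> \<Longrightarrow> a \<odot>\<^bsub>M\<^esub> x \<in> carrier M"
    and smult_l_distr:
      "\<lbrakk>a \<in> carrier R; b \<in> carrier R; x \<in> carrier M\<rbrakk> \<Longrightarrow>
        (a \<oplus>\<^bsub>R\<^esub> b) \<odot>\<^bsub>M\<^esub> x = a \<odot>\<^bsub>M\<^esub> x \<oplus>\<^bsub>M\<^esub> b \<odot>\<^bsub>M\<^esub> x"
    and smult_r_distr: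
      "\<lbrakk>a \<in> carrier R; x \<in> carrier M; y \<in> carrier M\<rbrakk> \<Longrightarrow>
        a \<odot>\<^bsub>M\<^esub> (x \<oplus>\<^bsub>M\<^esub> y) = a \<odot>\<^bsub>M\<^esub> x \<oplus>\<^bsub>M\<^esub> a \<odot>\<^bsub>M\<^esub> y"
    and smult_assoc:
      "\<lbrakk>a \<in> carrier R; b \<in> carrier R; x \<in> carrier M\<rbrakk> \<Longrightarrow>
        b \<odot>\<^bsub>M\<^esub> (a \<odot>\<^bsub>M\<^esub> x) = (a \<otimes>\<^bsub>R\<^esub> b) \<odot>\<^bsub>M\<^esub> x"
    and smult_one:
      "x \<in> carrier M \<Longrightarrow> \<one>\<^bsub>R\<^esub> \<odot>\<^bsub>M\<^esub> x = x"

definition fg_modules :: "('a, 'r) ring_scheme \<Rightarrow> ('a, 'm) module set" where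
  "fg_modules R = {M. right_module R M \<and> finitely_generated R M}"

(* Homomorphisms are total functions of which only the values on the carrier matter. *)
definition module_hom ::
    "('a, 'r) ring_scheme \<Rightarrow> ('a, 'm) module \<Rightarrow> ('a, 'n) module \<Rightarrow> ('m \<Rightarrow> 'n) set" where
  "module_hom R M N = {f \<in> hom (add_monoid M) (add_monoid N).
     \<forall>a \<in> carrier R. \<forall>x \<in> carrier M. f (a \<odot>\<^bsub>M\<^esub> x) = a \<odot>\<^bsub>N\<^esub> f x}"

definition module_isomorphic ::
    "('a, 'r) ring_scheme \<Rightarrow> ('a, 'm) module \<Rightarrow> ('a, 'n) module \<Rightarrow> bool" where
  "module_isomorphic R M N \<longleftrightarrow> (\<exists>f \<in> module_hom R M N. bij_betw f (carrier M) (carrier N))"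

(* The fields one and mult of a module record carry no information for modules. *)
definition regular_module :: "('a, 'r) ring_scheme \<Rightarrow> ('a, 'a) module" where
  "regular_module R =
     \<lparr>carrier = carrier R, monoid.mult = monoid.mult R, one = one R, zero = zero R, add = add R,
      smult = (\<lambda>a x. x \<otimes>\<^bsub>R\<^esub> a)\<rparr>"

definition simple_submodule ::
    "'m set \<Rightarrow> ('a, 'r) ring_scheme \<Rightarrow> ('a, 'm) module \<Rightarrow> bool" where
  "simple_submodule S R M \<longleftrightarrow> submodule S R M \<and> S \<noteq> {\<zero>\<^bsub>M\<^esub>} \<and>
     (\<forall>N. submodule N R M \<and> N \<subseteq> S \<longrightarrow> N = {\<zero>\<^bsub>M\<^esub>} \<or> N = S)"

definition socle :: "('a, 'r) ring_scheme \<Rightarrow> ('a, 'm) module \<Rightarrow> ('a, 'm) module" where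
  "socle R M = M\<lparr>carrier := generated_submodule R M (\<Union>{S. simple_submodule S R M})\<rparr>"

definition essential_submodule ::
    "'m set \<Rightarrow> ('a, 'r) ring_scheme \<Rightarrow> ('a, 'm) module \<Rightarrow> bool" where
  "essential_submodule N R M \<longleftrightarrow> submodule N R M \<and>
     (\<forall>U. submodule U R M \<and> U \<noteq> {\<zero>\<^bsub>M\<^esub>} \<longrightarrow> U \<inter> N \<noteq> {\<zero>\<^bsub>M\<^esub>})"


section \<open>Basic algebras\<close>

definition primitive_idempotent :: "('a, 'r) ring_scheme \<Rightarrow> 'a \<Rightarrow> bool" where
  "primitive_idempotent R e \<longleftrightarrow>
     e \<in> carrier R \<and> e \<otimes>\<^bsub>R\<^esub> e = e \<and> e \<noteq> \<zero>\<^bsub>R\<^esub> \<and>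
     (\<forall>f \<in> carrier R. \<forall>g \<in> carrier R.
        f \<otimes>\<^bsub>R\<^esub> f = f \<and> g \<otimes>\<^bsub>R\<^esub> g = g \<and> f \<otimes>\<^bsub>R\<^esub> g = \<zero>\<^bsub>R\<^esub> \<and> g \<otimes>\<^bsub>R\<^esub> f = \<zero>\<^bsub>R\<^esub> \<and>
        f \<oplus>\<^bsub>R\<^esub> g = e \<longrightarrow> f = \<zero>\<^bsub>R\<^esub> \<or> g = \<zero>\<^bsub>R\<^esub>)"

definition principal_module :: "('a, 'r) ring_scheme \<Rightarrow> 'a \<Rightarrow> ('a, 'a) module" where
  "principal_module R e = (regular_module R)\<lparr>carrier := (\<lambda>x. e \<otimes>\<^bsub>R\<^esub> x) ` carrier R\<rparr>"

definition basic_algebra :: "('a, 'r) ring_scheme \<Rightarrow> bool" where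
  "basic_algebra R \<longleftrightarrow> (\<exists>E. finite E \<and> (\<forall>e \<in> E. primitive_idempotent R e) \<and>
     (\<forall>e \<in> E. \<forall>f \<in> E. e \<noteq> f \<longrightarrow> e \<otimes>\<^bsub>R\<^esub> f = \<zero>\<^bsub>R\<^esub>) \<and>
     finsum R (\<lambda>e. e) E = \<one>\<^bsub>R\<^esub> \<and>
     (\<forall>e \<in> E. \<forall>f \<in> E. e \<noteq> f \<longrightarrow>
        \<not> module_isomorphic R (principal_module R e) (principal_module R f)))"


section \<open>Projective and injective modules, resolutions\<close>

(* Modules that are quantified over inside a definition have the carrier type 'a list.  This is no
   restriction up to isomorphism: in a module generated by n elements, every element is determined
   by a coefficient list of length n; see the lemma fg_modules_list_copy at the end. *)

definition projective_module :: "('a, 'r) ring_scheme \<Rightarrow> ('a, 'm) module \<Rightarrow> bool" where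
  "projective_module R P \<longleftrightarrow>
     (\<forall>N \<in> fg_modules R. \<forall>L \<in> fg_modules R. \<forall>g \<in> module_hom R N L. \<forall>f \<in> module_hom R P L.
        g ` carrier (N :: ('a, 'a list) module) = carrier (L :: ('a, 'a list) module) \<longrightarrow>
        (\<exists>h \<in> module_hom R P N. \<forall>x \<in> carrier P. g (h x) = f x))"

definition injective_module :: "('a, 'r) ring_scheme \<Rightarrow> ('a, 'm) module \<Rightarrow> bool" where
  "injective_module R I \<longleftrightarrow>
     (\<forall>N \<in> fg_modules R. \<forall>L \<in> fg_modules R. \<forall>g \<in> module_hom R N L. \<forall>f \<in> module_hom R N I.
        inj_on g (carrier (N :: ('a, 'a list) module)) \<longrightarrow>
        (\<exists>h \<in> module_hom R (L :: ('a, 'a list) module) I. \<forall>x \<in> carrier N. h (g x) = f x))"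

(* The exact sequence  ... --d 1--> P 1 --d 0--> P 0 --p--> M --> 0. *)
definition projective_resolution ::
    "('a, 'r) ring_scheme \<Rightarrow> ('a, 'm) module \<Rightarrow> ('a list \<Rightarrow> 'm) \<Rightarrow>
     (nat \<Rightarrow> ('a, 'a list) module) \<Rightarrow> (nat \<Rightarrow> 'a list \<Rightarrow> 'a list) \<Rightarrow> bool" where
  "projective_resolution R M p P d \<longleftrightarrow>
     (\<forall>i. P i \<in> fg_modules R \<and> projective_module R (P i)) \<and>
     p \<in> module_hom R (P 0) M \<and>
     (\<forall>i. d i \<in> module_hom R (P (Suc i)) (P i)) \<and>
     p ` carrier (P 0) = carrier M \<and>
     d 0 ` carrier (P 1) = a_kernel (P 0) M p \<and>
     (\<forall>i. d (Suc i) ` carrier (P (Suc (Suc i))) = a_kernel (P (Suc i)) (P i) (d i))"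

(* Inf {} = \<infinity>; the zero module gets dimension 0. *)
definition projective_dimension :: "('a, 'r) ring_scheme \<Rightarrow> ('a, 'm) module \<Rightarrow> enat" where
  "projective_dimension R M = Inf {enat n | n.
     \<exists>p P d. projective_resolution R M p P d \<and> (\<forall>i > n. carrier (P i) = {\<zero>\<^bsub>P i\<^esub>})}"

definition global_dimension :: "('a, 'r) ring_scheme \<Rightarrow> enat" where
  "global_dimension R =
     (SUP M \<in> (fg_modules R :: ('a, 'a list) module set). projective_dimension R M)"

(* The exact sequence  0 --> M --j--> I 0 --d 0--> I 1 --d 1--> ..., in which every I i is an
   injective envelope of the image of the preceding map. *)
definition minimal_injective_resolution ::
    "('a, 'r) ring_scheme \<Rightarrow> ('a, 'm) module \<Rightarrow> ('m \<Rightarrow> 'a list) \<Rightarrow>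
     (nat \<Rightarrow> ('a, 'a list) module) \<Rightarrow> (nat \<Rightarrow> 'a list \<Rightarrow> 'a list) \<Rightarrow> bool" where
  "minimal_injective_resolution R M j I d \<longleftrightarrow>
     (\<forall>i. I i \<in> fg_modules R \<and> injective_module R (I i)) \<and>
     j \<in> module_hom R M (I 0) \<and>
     (\<forall>i. d i \<in> module_hom R (I i) (I (Suc i))) \<and>
     inj_on j (carrier M) \<and>
     j ` carrier M = a_kernel (I 0) (I 1) (d 0) \<and>
     (\<forall>i. d i ` carrier (I i) = a_kernel (I (Suc i)) (I (Suc (Suc i))) (d (Suc i))) \<and>
     essential_submodule (j ` carrier M) R (I 0) \<and>
     (\<forall>i. essential_submodule (d i ` carrier (I i)) R (I (Suc i)))"

(* Minimal injective resolutions are unique up to isomorphism, so it does not matter which one is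
   taken. *)
definition dominant_dimension :: "('a, 'r) ring_scheme \<Rightarrow> enat" where
  "dominant_dimension R = Sup {enat n | n.
     \<exists>j I d. minimal_injective_resolution R (regular_module R) j I d \<and>
             (\<forall>i < n. projective_module R (I i))}"

definition auslander_algebra :: "('a, 'r) ring_scheme \<Rightarrow> bool" where
  "auslander_algebra R \<longleftrightarrow> global_dimension R \<le> 2 \<and> dominant_dimension R \<ge> 2"

(* The class of finitely generated modules of projective dimension at most n. *)
definition modules_pd_le :: "nat \<Rightarrow> ('a, 'r) ring_scheme \<Rightarrow> ('a, 'm) module set" where
  "modules_pd_le n R = {M \<in> fg_modules R. projective_dimension R M \<le> enat n}"

section \<open>Every finitely generated module has a copy with carrier type 'a list\<close>

context right_module
begin

lemma smult_zero: "a \<in> carrier R \<Longrightarrow> a \<odot>\<^bsub>M\<^esub> \<zero>\<^bsub>M\<^esub> = \<zero>\<^bsub>M\<^esub>"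
  using smult_r_distr[of a "\<zero>\<^bsub>M\<^esub>" "\<zero>\<^bsub>M\<^esub>"] smult_closed[of a "\<zero>\<^bsub>M\<^esub>"] by simp

lemma zero_smult: "x \<in> carrier M \<Longrightarrow> \<zero>\<^bsub>R\<^esub> \<odot>\<^bsub>M\<^esub> x = \<zero>\<^bsub>M\<^esub>"
  using smult_l_distr[of "\<zero>\<^bsub>R\<^esub>" "\<zero>\<^bsub>R\<^esub>" x] smult_closed[of "\<zero>\<^bsub>R\<^esub>" x] by simp

lemma minus_smult:
  assumes "a \<in> carrier R" "x \<in> carrier M"
  shows "(\<ominus>\<^bsub>R\<^esub> a) \<odot>\<^bsub>M\<^esub> x = \<ominus>\<^bsub>M\<^esub> (a \<odot>\<^bsub>M\<^esub> x)"
  using assms smult_l_distr[of "\<ominus>\<^bsub>R\<^esub> a" a x]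
  by (simp add: R.l_neg zero_smult M.minus_equality smult_closed)

lemma submoduleI:
  assumes "N \<subseteq> carrier M" "\<zero>\<^bsub>M\<^esub> \<in> N"
    and add: "\<And>x y. \<lbrakk>x \<in> N; y \<in> N\<rbrakk> \<Longrightarrow> x \<oplus>\<^bsub>M\<^esub> y \<in> N"
    and sm: "\<And>a x. \<lbrakk>a \<in> carrier R; x \<in> N\<rbrakk> \<Longrightarrow> a \<odot>\<^bsub>M\<^esub> x \<in> N"
  shows "submodule N R M"
proof -
  have "\<ominus>\<^bsub>M\<^esub> x \<in> N" if "x \<in> N" for x
  proof -
    have "x \<in> carrier M" using that assms(1) by blast
    then have "(\<ominus>\<^bsub>R\<^esub> \<one>\<^bsub>R\<^esub>) \<odot>\<^bsub>M\<^esub> x = \<ominus>\<^bsub>M\<^esub> x"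
      using minus_smult[of "\<one>\<^bsub>R\<^esub>" x] smult_one by simp
    then show ?thesis using sm[of "\<ominus>\<^bsub>R\<^esub> \<one>\<^bsub>R\<^esub>" x] that by simp
  qed
  then show ?thesis
    using assms by (intro submodule.intro subgroup.intro) (auto simp: submodule_axioms_def a_inv_def)
qed

lemma submodule_add_cyclic:
  assumes N: "submodule N R M" and x: "x \<in> carrier M"
  shows "submodule {a \<odot>\<^bsub>M\<^esub> x \<oplus>\<^bsub>M\<^esub> y | a y. a \<in> carrier R \<and> y \<in> N} R M" (is "submodule ?N R M")
proof -
  interpret N: submodule N R M by (rule N)
  have NM: "y \<in> carrier M" if "y \<in> N" for y using that N.subset by auto
  show ?thesis
  proof (rule submoduleI)
    show "?N \<subseteq> carrier M" using NM x smult_closed by auto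
    have "\<zero>\<^bsub>M\<^esub> = \<zero>\<^bsub>R\<^esub> \<odot>\<^bsub>M\<^esub> x \<oplus>\<^bsub>M\<^esub> \<zero>\<^bsub>M\<^esub>" using x by (simp add: zero_smult)
    then show "\<zero>\<^bsub>M\<^esub> \<in> ?N" using N.one_closed by auto
  next
    fix u v assume "u \<in> ?N" "v \<in> ?N"
    then obtain a y b z where u: "u = a \<odot>\<^bsub>M\<^esub> x \<oplus>\<^bsub>M\<^esub> y" "a \<in> carrier R" "y \<in> N"
      and v: "v = b \<odot>\<^bsub>M\<^esub> x \<oplus>\<^bsub>M\<^esub> z" "b \<in> carrier R" "z \<in> N" by blast
    have "u \<oplus>\<^bsub>M\<^esub> v = (a \<oplus>\<^bsub>R\<^esub> b) \<odot>\<^bsub>M\<^esub> x \<oplus>\<^bsub>M\<^esub> (y \<oplus>\<^bsub>M\<^esub> z)"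
      using u v x NM by (simp add: smult_l_distr smult_closed M.add.m_ac)
    moreover have "y \<oplus>\<^bsub>M\<^esub> z \<in> N" using N.m_closed u v by simp
    ultimately show "u \<oplus>\<^bsub>M\<^esub> v \<in> ?N" using u v R.add.m_closed by blast
  next
    fix c u assume c: "c \<in> carrier R" and "u \<in> ?N"
    then obtain a y where u: "u = a \<odot>\<^bsub>M\<^esub> x \<oplus>\<^bsub>M\<^esub> y" "a \<in> carrier R" "y \<in> N" by blast
    have "c \<odot>\<^bsub>M\<^esub> u = (a \<otimes>\<^bsub>R\<^esub> c) \<odot>\<^bsub>M\<^esub> x \<oplus>\<^bsub>M\<^esub> c \<odot>\<^bsub>M\<^esub> y"
      using u c x NM by (simp add: smult_r_distr smult_closed smult_assoc)
    then show "c \<odot>\<^bsub>M\<^esub> u \<in> ?N" using u c N.smult_closed R.m_closed by blast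
  qed
qed

lemma fg_inj_to_lists:
  assumes "finitely_generated R M"
  shows "\<exists>g :: 'm \<Rightarrow> 'a list. inj_on g (carrier M)"
proof -
  have *: "\<exists>N (g :: 'm \<Rightarrow> 'a list). submodule N R M \<and> B \<subseteq> N \<and> inj_on g N"
    if "finite B" "B \<subseteq> carrier M" for B
    using that
  proof (induction B)
    case empty
    have "submodule {\<zero>\<^bsub>M\<^esub>} R M" by (rule submoduleI) (auto simp: smult_zero)
    then show ?case by (intro exI[of _ "{\<zero>\<^bsub>M\<^esub>}"]) auto
  next
    case (insert x B)
    then obtain N and g :: "'m \<Rightarrow> 'a list"
      where N: "submodule N R M" "B \<subseteq> N" "inj_on g N" by auto
    have x: "x \<in> carrier M" using insert by auto
    interpret N: submodule N R M by (rule N(1))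
    have NM: "y \<in> carrier M" if "y \<in> N" for y using that N.subset by auto
    let ?N = "{a \<odot>\<^bsub>M\<^esub> x \<oplus>\<^bsub>M\<^esub> y | a y. a \<in> carrier R \<and> y \<in> N}"
    have "\<forall>u \<in> ?N. \<exists>p. snd p \<in> N \<and> fst p \<odot>\<^bsub>M\<^esub> x \<oplus>\<^bsub>M\<^esub> snd p = u" by auto
    from bchoice[OF this] obtain q
      where q: "\<forall>u \<in> ?N. snd (q u) \<in> N \<and> fst (q u) \<odot>\<^bsub>M\<^esub> x \<oplus>\<^bsub>M\<^esub> snd (q u) = u" ..
    have "inj_on (\<lambda>u. fst (q u) # g (snd (q u))) ?N"
    proof (rule inj_onI)
      fix u v assume uv: "u \<in> ?N" "v \<in> ?N"
        "fst (q u) # g (snd (q u)) = fst (q v) # g (snd (q v))"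
      have qu: "snd (q u) \<in> N" "fst (q u) \<odot>\<^bsub>M\<^esub> x \<oplus>\<^bsub>M\<^esub> snd (q u) = u"
        and qv: "snd (q v) \<in> N" "fst (q v) \<odot>\<^bsub>M\<^esub> x \<oplus>\<^bsub>M\<^esub> snd (q v) = v"
        using bspec[OF q uv(1)] bspec[OF q uv(2)] by blast+
      have "fst (q u) = fst (q v)" "g (snd (q u)) = g (snd (q v))" using uv(3) by simp_all
      moreover from this(2) have "snd (q u) = snd (q v)" by (rule inj_onD[OF N(3) _ qu(1) qv(1)])
      ultimately have "fst (q u) \<odot>\<^bsub>M\<^esub> x \<oplus>\<^bsub>M\<^esub> snd (q u) = fst (q v) \<odot>\<^bsub>M\<^esub> x \<oplus>\<^bsub>M\<^esub> snd (q v)"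
        by (simp only:)
      then show "u = v" unfolding qu(2) qv(2) .
    qed
    moreover have "x \<in> ?N"
    proof -
      have "x = \<one>\<^bsub>R\<^esub> \<odot>\<^bsub>M\<^esub> x \<oplus>\<^bsub>M\<^esub> \<zero>\<^bsub>M\<^esub>" using x by (simp add: smult_one)
      then show ?thesis using N.one_closed by auto
    qed
    moreover have "B \<subseteq> ?N"
    proof
      fix y assume "y \<in> B"
      then have "y \<in> N" using N by auto
      moreover from this have "y = \<zero>\<^bsub>R\<^esub> \<odot>\<^bsub>M\<^esub> x \<oplus>\<^bsub>M\<^esub> y" using x NM by (simp add: zero_smult)
      ultimately show "y \<in> ?N" by blast
    qed
    ultimately show ?case using submodule_add_cyclic[OF N(1) x] by blast
  qed
  obtain B where B: "finite B" "B \<subseteq> carrier M" "generated_submodule R M B = carrier M"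
    using assms unfolding finitely_generated_def by blast
  then obtain N and g :: "'m \<Rightarrow> 'a list"
    where N: "submodule N R M" "B \<subseteq> N" "inj_on g N" using * by blast
  then have "carrier M \<subseteq> N" using B(3) unfolding generated_submodule_def by blast
  then show ?thesis using N(3) inj_on_subset by blast
qed

end

lemma fg_modules_list_copy:
  fixes M :: "('a, 'm) module"
  assumes "M \<in> fg_modules R"
  shows "\<exists>N :: ('a, 'a list) module. N \<in> fg_modules R \<and> module_isomorphic R M N"
proof -
  interpret right_module R M using assms by (simp add: fg_modules_def)
  have fg: "finitely_generated R M" using assms by (simp add: fg_modules_def)
  obtain g :: "'m \<Rightarrow> 'a list" where g: "inj_on g (carrier M)"
    using fg_inj_to_lists[OF fg] by blast
  define h where "h = inv_into (carrier M) g"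
  have hg [simp]: "h (g x) = x" if "x \<in> carrier M" for x
    using g that by (simp add: h_def)
  define N :: "('a, 'a list) module" where
    "N = \<lparr>carrier = g ` carrier M, monoid.mult = undefined, one = undefined,
          zero = g \<zero>\<^bsub>M\<^esub>, add = (\<lambda>u v. g (h u \<oplus>\<^bsub>M\<^esub> h v)),
          smult = (\<lambda>a u. g (a \<odot>\<^bsub>M\<^esub> h u))\<rparr>"
  have N [simp]: "carrier N = g ` carrier M" "\<zero>\<^bsub>N\<^esub> = g \<zero>\<^bsub>M\<^esub>"
    "\<And>u v. u \<oplus>\<^bsub>N\<^esub> v = g (h u \<oplus>\<^bsub>M\<^esub> h v)" "\<And>a u. a \<odot>\<^bsub>N\<^esub> u = g (a \<odot>\<^bsub>M\<^esub> h u)"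
    by (simp_all add: N_def)
  have "abelian_group N"
  proof (rule abelian_groupI)
    fix u assume "u \<in> carrier N"
    then obtain x where x: "u = g x" "x \<in> carrier M" by auto
    then show "\<exists>v \<in> carrier N. v \<oplus>\<^bsub>N\<^esub> u = \<zero>\<^bsub>N\<^esub>"
      by (intro bexI[of _ "g (\<ominus>\<^bsub>M\<^esub> x)"]) (auto simp: M.l_neg)
  qed (auto simp: M.add.m_ac)
  then have rN: "right_module R N"
    by (intro right_module.intro right_module_axioms.intro R.ring_axioms)
      (auto simp: smult_closed smult_l_distr smult_r_distr smult_assoc smult_one)
  have iso: "module_isomorphic R M N"
    unfolding module_isomorphic_def module_hom_def
    using g by (intro bexI[of _ g]) (auto simp: hom_def bij_betw_def)
  obtain B where B: "finite B" "B \<subseteq> carrier M" "generated_submodule R M B = carrier M"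
    using fg unfolding finitely_generated_def by blast
  have least: "carrier N \<subseteq> U" if U: "submodule U R N" "g ` B \<subseteq> U" for U
  proof -
    interpret U: submodule U R N by (rule U(1))
    have "submodule {x \<in> carrier M. g x \<in> U} R M"
    proof (rule submoduleI)
      show "\<zero>\<^bsub>M\<^esub> \<in> {x \<in> carrier M. g x \<in> U}" using U.one_closed by simp
    next
      fix x y assume "x \<in> {x \<in> carrier M. g x \<in> U}" "y \<in> {x \<in> carrier M. g x \<in> U}"
      then show "x \<oplus>\<^bsub>M\<^esub> y \<in> {x \<in> carrier M. g x \<in> U}"
        using U.m_closed[of "g x" "g y"] by simp
    next
      fix a x assume "a \<in> carrier R" "x \<in> {x \<in> carrier M. g x \<in> U}"
      then show "a \<odot>\<^bsub>M\<^esub> x \<in> {x \<in> carrier M. g x \<in> U}"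
        using U.smult_closed[of a "g x"] smult_closed by simp
    qed auto
    moreover have "B \<subseteq> {x \<in> carrier M. g x \<in> U}" using U(2) B(2) by auto
    ultimately have "carrier M \<subseteq> {x \<in> carrier M. g x \<in> U}"
      using B(3) unfolding generated_submodule_def by blast
    then show ?thesis by auto
  qed
  have "submodule (carrier N) R N"
    by (rule right_module.submoduleI[OF rN]) (auto simp: smult_closed)
  then have "generated_submodule R N (g ` B) \<subseteq> carrier N"
    using B(2) unfolding generated_submodule_def by (intro Inter_lower) auto
  moreover have "carrier N \<subseteq> generated_submodule R N (g ` B)"
    unfolding generated_submodule_def using least by (intro Inter_greatest) blast
  ultimately have "generated_submodule R N (g ` B) = carrier N" by (rule equalityI)
  then have "finitely_generated R N"
    unfolding finitely_generated_def using B by (intro exI[of _ "g ` B"]) auto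
  then show ?thesis using rN iso unfolding fg_modules_def by blast
qed

end

theory Submission
  imports Defs
begin

text \<open>
  Let \<open>0 \<rightarrow> \<Lambda> \<rightarrow> I\<^sub>0 \<rightarrow> I\<^sub>1\<close> be the start of the minimal injective resolution of the Auslander algebra
  \<open>\<Lambda>\<close>, so that \<open>I\<^sub>0\<close> and \<open>I\<^sub>1\<close> are both projective and injective.

  Since the global dimension is at most two, modules of projective dimension at most one are closed
  under submodules (\<open>submodule_pd_le_one\<close>): for \<open>N \<subseteq> M\<close> the functor \<open>Ext\<^sup>2(N, -)\<close> sits between
  \<open>Ext\<^sup>2(M, -)\<close> and \<open>Ext\<^sup>3(M/N, -) = 0\<close>.  In particular \<open>pd M \<le> 1\<close> gives \<open>pd soc M \<le> 1\<close>.

  For the converse, let \<open>N \<noteq> 0\<close> have \<open>pd N \<le> 1\<close>.  Then one of \<open>Hom(N, \<Lambda>)\<close> and \<open>Ext\<^sup>1(N, \<Lambda>)\<close> is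
  not zero: otherwise the syzygy of \<open>N\<close>, being projective, splits off from the projective module
  covering \<open>N\<close>, so \<open>N\<close> is projective and embeds in a free module, although \<open>Hom(N, \<Lambda>) = 0\<close>.
  Reading both groups off the injective resolution yields a nonzero homomorphism from \<open>N\<close> to \<open>I\<^sub>0\<close>
  or \<open>I\<^sub>1\<close> (\<open>nonzero_hom_if_pd_le_one\<close>).  Now suppose \<open>pd soc M \<le> 1\<close>, and choose a homomorphism
  \<open>f\<close> from \<open>M\<close> to a projective module with a kernel of least possible length.  If the kernel is
  not zero, it meets the essential submodule \<open>soc M\<close> in a nonzero module \<open>N\<close> with \<open>pd N \<le> 1\<close>; a
  nonzero homomorphism \<open>N \<rightarrow> I\<^sub>i\<close> extends to \<open>g : M \<rightarrow> I\<^sub>i\<close> by injectivity, and \<open>(f, g)\<close> maps to a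
  projective module again with a smaller kernel.  Hence \<open>f\<close> is injective
  (\<open>embeds_in_projective_if_socle_pd_le_one\<close>), and \<open>M\<close>, a submodule of a projective module, has
  projective dimension at most one.

  Ext groups never occur explicitly.  Projective dimension at most one is expressed by one
  surjection from a projective module with projective kernel, and the vanishing of \<open>Ext\<^sup>1(N, F)\<close>
  by extending homomorphisms from the kernel of such a map to its source.  Chain conditions come
  from a rank function on submodules, which plays the role of the length.
\<close>

section \<open>Homomorphisms and submodules\<close>

context abelian_group
begin

lemma diff_eq_zero_iff:
  "\<lbrakk>x \<in> carrier G; y \<in> carrier G\<rbrakk> \<Longrightarrow> x \<ominus> y = \<zero> \<longleftrightarrow> x = y"
  by (metis add.inv_closed add.inv_inv minus_eq minus_equality r_neg)

lemma diff_add_cancel: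
  "\<lbrakk>x \<in> carrier G; y \<in> carrier G\<rbrakk> \<Longrightarrow> (x \<ominus> y) \<oplus> y = x"
  by (simp add: minus_eq a_assoc l_neg)

lemma add_diff_cancel:
  "\<lbrakk>x \<in> carrier G; y \<in> carrier G\<rbrakk> \<Longrightarrow> (x \<oplus> y) \<ominus> y = x"
  by (simp add: minus_eq a_assoc r_neg)

lemma diff_zero: "x \<in> carrier G \<Longrightarrow> x \<ominus> \<zero> = x"
  using diff_add_cancel[of x "\<zero>"] by simp

end

lemma module_homI:
  assumes "\<And>x. x \<in> carrier M \<Longrightarrow> f x \<in> carrier N"
    and "\<And>x y. \<lbrakk>x \<in> carrier M; y \<in> carrier M\<rbrakk> \<Longrightarrow> f (x \<oplus>\<^bsub>M\<^esub> y) = f x \<oplus>\<^bsub>N\<^esub> f y"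
    and "\<And>a x. \<lbrakk>a \<in> carrier R; x \<in> carrier M\<rbrakk> \<Longrightarrow> f (a \<odot>\<^bsub>M\<^esub> x) = a \<odot>\<^bsub>N\<^esub> f x"
  shows "f \<in> module_hom R M N"
  using assms by (auto simp: module_hom_def hom_def)

lemma hom_closed: "\<lbrakk>f \<in> module_hom R M N; x \<in> carrier M\<rbrakk> \<Longrightarrow> f x \<in> carrier N"
  by (auto simp: module_hom_def hom_def)

lemma hom_add:
  "\<lbrakk>f \<in> module_hom R M N; x \<in> carrier M; y \<in> carrier M\<rbrakk> \<Longrightarrow>
    f (x \<oplus>\<^bsub>M\<^esub> y) = f x \<oplus>\<^bsub>N\<^esub> f y"
  by (auto simp: module_hom_def hom_def)

lemma hom_smult:
  "\<lbrakk>f \<in> module_hom R M N; a \<in> carrier R; x \<in> carrier M\<rbrakk> \<Longrightarrow> f (a \<odot>\<^bsub>M\<^esub> x) = a \<odot>\<^bsub>N\<^esub> f x"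
  by (auto simp: module_hom_def)

lemma hom_zero:
  assumes "right_module R M" "right_module R N" "f \<in> module_hom R M N"
  shows "f \<zero>\<^bsub>M\<^esub> = \<zero>\<^bsub>N\<^esub>"
proof -
  interpret M: right_module R M by fact
  interpret N: right_module R N by fact
  have "f \<zero>\<^bsub>M\<^esub> \<oplus>\<^bsub>N\<^esub> f \<zero>\<^bsub>M\<^esub> = f \<zero>\<^bsub>M\<^esub> \<oplus>\<^bsub>N\<^esub> \<zero>\<^bsub>N\<^esub>"
    using hom_add[OF assms(3), of "\<zero>\<^bsub>M\<^esub>" "\<zero>\<^bsub>M\<^esub>"] hom_closed[OF assms(3), of "\<zero>\<^bsub>M\<^esub>"] by simp
  then show ?thesis using hom_closed[OF assms(3), of "\<zero>\<^bsub>M\<^esub>"]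
    by (simp add: N.M.add.l_cancel del: N.M.r_zero)
qed

lemma hom_diff:
  assumes "right_module R M" "right_module R N" "f \<in> module_hom R M N"
    "x \<in> carrier M" "y \<in> carrier M"
  shows "f (x \<ominus>\<^bsub>M\<^esub> y) = f x \<ominus>\<^bsub>N\<^esub> f y"
proof -
  interpret M: right_module R M by fact
  interpret N: right_module R N by fact
  have "f (x \<ominus>\<^bsub>M\<^esub> y) \<oplus>\<^bsub>N\<^esub> f y = f x"
    using hom_add[OF assms(3), of "x \<ominus>\<^bsub>M\<^esub> y" y] assms
    by (simp add: M.M.minus_eq M.M.a_assoc M.M.l_neg)
  then show ?thesis
    using hom_closed[OF assms(3)] assms
    by (metis M.M.minus_closed N.M.add.inv_closed N.M.add.m_assoc N.M.minus_eq N.M.r_neg N.M.r_zero)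
qed

lemma hom_id: "(\<lambda>x. x) \<in> module_hom R M M"
  by (auto intro: module_homI)

lemma hom_comp:
  "\<lbrakk>f \<in> module_hom R M N; g \<in> module_hom R N L\<rbrakk> \<Longrightarrow> (\<lambda>x. g (f x)) \<in> module_hom R M L"
  by (intro module_homI) (simp_all add: hom_closed hom_add hom_smult)

lemma hom_plus:
  assumes "right_module R N" "f \<in> module_hom R M N" "g \<in> module_hom R M N"
  shows "(\<lambda>x. f x \<oplus>\<^bsub>N\<^esub> g x) \<in> module_hom R M N"
proof -
  interpret N: right_module R N by fact
  show ?thesis using hom_closed[OF assms(2)] hom_closed[OF assms(3)]
    by (intro module_homI)
      (simp_all add: hom_add[OF assms(2)] hom_add[OF assms(3)] hom_smult[OF assms(2)]
        hom_smult[OF assms(3)] N.smult_r_distr N.M.add.m_ac)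
qed

lemma hom_minus:
  assumes "right_module R N" "f \<in> module_hom R M N" "g \<in> module_hom R M N"
  shows "(\<lambda>x. f x \<ominus>\<^bsub>N\<^esub> g x) \<in> module_hom R M N"
proof -
  interpret N: right_module R N by fact
  have "a \<odot>\<^bsub>N\<^esub> (\<ominus>\<^bsub>N\<^esub> y) = \<ominus>\<^bsub>N\<^esub> (a \<odot>\<^bsub>N\<^esub> y)" if "a \<in> carrier R" "y \<in> carrier N" for a y
    using N.smult_r_distr[of a "\<ominus>\<^bsub>N\<^esub> y" y] that
    by (simp add: N.M.l_neg N.smult_zero N.M.minus_equality N.smult_closed)
  then show ?thesis using hom_closed[OF assms(2)] hom_closed[OF assms(3)]
    by (intro module_homI)
      (simp_all add: hom_add[OF assms(2)] hom_add[OF assms(3)] hom_smult[OF assms(2)]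
        hom_smult[OF assms(3)] N.smult_r_distr N.M.add.m_ac N.M.minus_eq N.M.minus_add)
qed

lemma hom_inv:
  assumes f: "f \<in> module_hom R M N" "bij_betw f (carrier M) (carrier N)"
    and "right_module R M" "right_module R N"
  shows "inv_into (carrier M) f \<in> module_hom R N M"
    "bij_betw (inv_into (carrier M) f) (carrier N) (carrier M)"
proof -
  let ?g = "inv_into (carrier M) f"
  interpret M: right_module R M by fact
  interpret N: right_module R N by fact
  show g: "bij_betw ?g (carrier N) (carrier M)" using f(2) by (rule bij_betw_inv_into)
  have gM: "?g y \<in> carrier M" if "y \<in> carrier N" for y using g that by (auto simp: bij_betw_def)
  have fg: "f (?g y) = y" if "y \<in> carrier N" for y
    using f(2) that by (simp add: bij_betw_def f_inv_into_f)
  have gf: "?g (f x) = x" if "x \<in> carrier M" for x using f(2) that by (simp add: bij_betw_def)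
  show "?g \<in> module_hom R N M"
  proof (rule module_homI)
    fix x y assume xy: "x \<in> carrier N" "y \<in> carrier N"
    have "?g (f (?g x \<oplus>\<^bsub>M\<^esub> ?g y)) = ?g x \<oplus>\<^bsub>M\<^esub> ?g y" using xy gM by (intro gf) simp
    then show "?g (x \<oplus>\<^bsub>N\<^esub> y) = ?g x \<oplus>\<^bsub>M\<^esub> ?g y"
      using xy by (simp add: hom_add[OF f(1)] gM fg)
  next
    fix a x assume ax: "a \<in> carrier R" "x \<in> carrier N"
    have "?g (f (a \<odot>\<^bsub>M\<^esub> ?g x)) = a \<odot>\<^bsub>M\<^esub> ?g x" using ax gM by (intro gf) (simp add: M.smult_closed)
    then show "?g (a \<odot>\<^bsub>N\<^esub> x) = a \<odot>\<^bsub>M\<^esub> ?g x"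
      using ax by (simp add: hom_smult[OF f(1)] gM fg)
  qed (rule gM)
qed

text \<open>The locale of submodules demands closure under negation, which is automatic as \<open>-x\<close> is the
  multiple of \<open>x\<close> by \<open>-1\<close>.\<close>

lemma submodule_iff:
  assumes "right_module R M"
  shows "submodule N R M \<longleftrightarrow> N \<subseteq> carrier M \<and> \<zero>\<^bsub>M\<^esub> \<in> N \<and>
    (\<forall>x\<in>N. \<forall>y\<in>N. x \<oplus>\<^bsub>M\<^esub> y \<in> N) \<and> (\<forall>a\<in>carrier R. \<forall>x\<in>N. a \<odot>\<^bsub>M\<^esub> x \<in> N)"
proof
  assume "submodule N R M"
  then interpret N: submodule N R M .
  show "N \<subseteq> carrier M \<and> \<zero>\<^bsub>M\<^esub> \<in> N \<and>
    (\<forall>x\<in>N. \<forall>y\<in>N. x \<oplus>\<^bsub>M\<^esub> y \<in> N) \<and> (\<forall>a\<in>carrier R. \<forall>x\<in>N. a \<odot>\<^bsub>M\<^esub> x \<in> N)"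
    using N.subset N.one_closed N.m_closed N.smult_closed by auto
next
  assume "N \<subseteq> carrier M \<and> \<zero>\<^bsub>M\<^esub> \<in> N \<and>
    (\<forall>x\<in>N. \<forall>y\<in>N. x \<oplus>\<^bsub>M\<^esub> y \<in> N) \<and> (\<forall>a\<in>carrier R. \<forall>x\<in>N. a \<odot>\<^bsub>M\<^esub> x \<in> N)"
  then show "submodule N R M" by (intro right_module.submoduleI[OF assms]) auto
qed

lemma submodule_neg:
  assumes "right_module R M" "submodule N R M" "x \<in> N"
  shows "\<ominus>\<^bsub>M\<^esub> x \<in> N"
proof -
  interpret N: submodule N R M by fact
  show ?thesis using N.m_inv_closed[OF assms(3)] by (simp add: a_inv_def)
qed

lemma submodule_diff:
  assumes "right_module R M" "submodule N R M" "x \<in> N" "y \<in> N"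
  shows "x \<ominus>\<^bsub>M\<^esub> y \<in> N"
  using assms submodule_neg[OF assms(1,2,4)] by (simp add: submodule_iff a_minus_def)

lemma right_module_submodule:
  assumes M: "right_module R M" and N: "submodule N R M"
  shows "right_module R (M\<lparr>carrier := N\<rparr>)"
proof -
  interpret M: right_module R M by fact
  have sub: "N \<subseteq> carrier M" "\<zero>\<^bsub>M\<^esub> \<in> N" "\<And>x y. x \<in> N \<Longrightarrow> y \<in> N \<Longrightarrow> x \<oplus>\<^bsub>M\<^esub> y \<in> N"
    "\<And>a x. a \<in> carrier R \<Longrightarrow> x \<in> N \<Longrightarrow> a \<odot>\<^bsub>M\<^esub> x \<in> N"
    using N by (auto simp: submodule_iff[OF M])
  have NM: "x \<in> carrier M" if "x \<in> N" for x using sub that by auto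
  have "abelian_group (M\<lparr>carrier := N\<rparr>)"
  proof (rule abelian_groupI)
    fix x assume x: "x \<in> carrier (M\<lparr>carrier := N\<rparr>)"
    then show "\<exists>y\<in>carrier (M\<lparr>carrier := N\<rparr>). y \<oplus>\<^bsub>M\<lparr>carrier := N\<rparr>\<^esub> x = \<zero>\<^bsub>M\<lparr>carrier := N\<rparr>\<^esub>"
      using submodule_neg[OF M N] NM by (intro bexI[of _ "\<ominus>\<^bsub>M\<^esub> x"]) (auto simp: M.M.l_neg)
  qed (auto simp: sub NM M.M.add.m_ac)
  then show ?thesis
    by (intro right_module.intro right_module_axioms.intro M.R.ring_axioms)
      (auto simp: NM sub M.smult_l_distr M.smult_r_distr M.smult_assoc M.smult_one)
qed

lemma submodule_submodule_iff:
  assumes M: "right_module R M" and N: "submodule N R M"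
  shows "submodule U R (M\<lparr>carrier := N\<rparr>) \<longleftrightarrow> submodule U R M \<and> U \<subseteq> N"
  using N by (auto simp: submodule_iff[OF M] submodule_iff[OF right_module_submodule[OF M N]])

lemma submodule_carrier: "right_module R M \<Longrightarrow> submodule (carrier M) R M"
  by (simp add: submodule_iff right_module.smult_closed abelian_group.axioms 
    right_module.axioms abelian_monoid.a_closed abelian_group.axioms(1) abelian_monoid.zero_closed)

lemma submodule_zero: "right_module R M \<Longrightarrow> submodule {\<zero>\<^bsub>M\<^esub>} R M"
  by (simp add: submodule_iff right_module.smult_zero 
    right_module.axioms abelian_monoid.l_zero abelian_group.axioms(1) abelian_monoid.zero_closed)

lemma submodule_Int:
  "\<lbrakk>right_module R M; submodule U R M; submodule V R M\<rbrakk> \<Longrightarrow> submodule (U \<inter> V) R M"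
  by (auto simp: submodule_iff)

lemma kernel_iff: "x \<in> a_kernel M N f \<longleftrightarrow> x \<in> carrier M \<and> f x = \<zero>\<^bsub>N\<^esub>"
  by (simp add: a_kernel_def')

lemma a_kernel_update_codomain [simp]: "a_kernel M (N\<lparr>carrier := V\<rparr>) f = a_kernel M N f"
  by (auto simp: kernel_iff)

lemma submodule_vimage:
  assumes "right_module R M" "right_module R N" "f \<in> module_hom R M N" "submodule V R N"
  shows "submodule {x \<in> carrier M. f x \<in> V} R M"
proof -
  interpret M: right_module R M by fact
  show ?thesis using assms(4)
    by (auto simp: submodule_iff[OF assms(1)] submodule_iff[OF assms(2)] hom_zero[OF assms(1-3)]
        hom_add[OF assms(3)] hom_smult[OF assms(3)] M.smult_closed)
qed

lemma submodule_kernel: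
  assumes "right_module R M" "right_module R N" "f \<in> module_hom R M N"
  shows "submodule (a_kernel M N f) R M"
proof -
  have "a_kernel M N f = {x \<in> carrier M. f x \<in> {\<zero>\<^bsub>N\<^esub>}}" by (auto simp: kernel_iff)
  then show ?thesis using submodule_vimage[OF assms submodule_zero[OF assms(2)]] by simp
qed

lemma submodule_image:
  assumes "right_module R M" "right_module R N" "f \<in> module_hom R M N" "submodule U R M"
  shows "submodule (f ` U) R N"
proof -
  have U: "U \<subseteq> carrier M" using assms by (simp add: submodule_iff)
  then have UM: "x \<in> carrier M" if "x \<in> U" for x using that by blast
  have "\<zero>\<^bsub>N\<^esub> \<in> f ` U"
    using hom_zero[OF assms(1-3)] assms(4) by (force simp: submodule_iff[OF assms(1)])
  moreover have "f x \<oplus>\<^bsub>N\<^esub> f y \<in> f ` U" if "x \<in> U" "y \<in> U" for x y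
    using hom_add[OF assms(3), of x y] UM that assms(4)
    by (metis image_eqI submodule_iff[OF assms(1)])
  moreover have "a \<odot>\<^bsub>N\<^esub> f x \<in> f ` U" if "a \<in> carrier R" "x \<in> U" for a x
    using hom_smult[OF assms(3), of a x] UM that assms(4)
    by (metis image_eqI submodule_iff[OF assms(1)])
  ultimately show ?thesis using UM hom_closed[OF assms(3)]
    by (auto simp: submodule_iff[OF assms(2)])
qed

lemma hom_inj_iff:
  assumes "right_module R M" "right_module R N" "f \<in> module_hom R M N"
  shows "inj_on f (carrier M) \<longleftrightarrow> (\<forall>x\<in>carrier M. f x = \<zero>\<^bsub>N\<^esub> \<longrightarrow> x = \<zero>\<^bsub>M\<^esub>)"
proof -
  interpret M: right_module R M by fact
  interpret N: right_module R N by fact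
  show ?thesis
  proof
    assume "inj_on f (carrier M)"
    then show "\<forall>x\<in>carrier M. f x = \<zero>\<^bsub>N\<^esub> \<longrightarrow> x = \<zero>\<^bsub>M\<^esub>"
      using hom_zero[OF assms] by (metis M.M.zero_closed inj_onD)
  next
    assume *: "\<forall>x\<in>carrier M. f x = \<zero>\<^bsub>N\<^esub> \<longrightarrow> x = \<zero>\<^bsub>M\<^esub>"
    show "inj_on f (carrier M)"
    proof (rule inj_onI)
      fix x y assume xy: "x \<in> carrier M" "y \<in> carrier M" "f x = f y"
      then have "f (x \<ominus>\<^bsub>M\<^esub> y) = \<zero>\<^bsub>N\<^esub>"
        using hom_diff[OF assms] hom_closed[OF assms(3)] by (simp add: N.M.minus_eq N.M.r_neg)
      then have "x \<ominus>\<^bsub>M\<^esub> y = \<zero>\<^bsub>M\<^esub>" using * xy by simp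
      then show "x = y" using xy by (simp add: M.M.diff_eq_zero_iff)
    qed
  qed
qed

lemma hom_restrict:
  "\<lbrakk>f \<in> module_hom R M N; U \<subseteq> carrier M\<rbrakk> \<Longrightarrow> f \<in> module_hom R (M\<lparr>carrier := U\<rparr>) N"
  by (intro module_homI) (auto simp: hom_closed subset_iff intro: hom_add hom_smult)

lemma hom_corestrict:
  "\<lbrakk>f \<in> module_hom R M N; f ` carrier M \<subseteq> V\<rbrakk> \<Longrightarrow> f \<in> module_hom R M (N\<lparr>carrier := V\<rparr>)"
  by (intro module_homI) (auto intro: hom_add hom_smult)

lemma hom_expand:
  "\<lbrakk>f \<in> module_hom R M (N\<lparr>carrier := V\<rparr>); V \<subseteq> carrier N\<rbrakk> \<Longrightarrow> f \<in> module_hom R M N"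
  by (auto simp: module_hom_def hom_def)

lemma generated_submodule_least:
  "\<lbrakk>submodule N R M; U \<subseteq> N\<rbrakk> \<Longrightarrow> generated_submodule R M U \<subseteq> N"
  unfolding generated_submodule_def by (intro Inter_lower) simp

lemma generated_submodule_superset: "U \<subseteq> generated_submodule R M U"
  unfolding generated_submodule_def by (intro Inter_greatest) simp

lemma submodule_generated:
  assumes M: "right_module R M" and "U \<subseteq> carrier M"
  shows "submodule (generated_submodule R M U) R M"
proof -
  have "generated_submodule R M U \<subseteq> carrier M"
    using assms by (intro generated_submodule_least submodule_carrier)
  then show ?thesis
    unfolding submodule_iff[OF M] generated_submodule_def by auto
qed

section \<open>Length of submodules\<close>

lemma right_module_regular:
  assumes "ring R"
  shows "right_module R (regular_module R)"
proof -
  interpret ring R by fact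
  have "abelian_group (regular_module R)"
    by (rule abelian_groupI) (auto simp: regular_module_def a_ac intro: l_neg)
  then show ?thesis
    by (intro right_module.intro right_module_axioms.intro ring_axioms)
      (auto simp: regular_module_def l_distr r_distr m_assoc)
qed

lemma submodule_regular_iff:
  assumes "ring R"
  shows "submodule J R (regular_module R) \<longleftrightarrow> J \<subseteq> carrier R \<and> \<zero>\<^bsub>R\<^esub> \<in> J \<and>
    (\<forall>x\<in>J. \<forall>y\<in>J. x \<oplus>\<^bsub>R\<^esub> y \<in> J) \<and> (\<forall>a\<in>carrier R. \<forall>x\<in>J. x \<otimes>\<^bsub>R\<^esub> a \<in> J)"
  unfolding submodule_iff[OF right_module_regular[OF assms]] by (simp add: regular_module_def)

text \<open>Any strictly monotone numerical function on the lattice of submodules can replace the length: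
  it yields both chain conditions without composition series and the Jordan-Hoelder theorem.\<close>

definition submodule_rank ::
    "('a, 'r) ring_scheme \<Rightarrow> ('a, 'm) module \<Rightarrow> 'm set \<Rightarrow> ('m set \<Rightarrow> nat) \<Rightarrow> bool" where
  "submodule_rank R M N \<rho> \<longleftrightarrow>
     (\<forall>U V. submodule U R M \<and> submodule V R M \<and> U \<subset> V \<and> V \<subseteq> N \<longrightarrow> \<rho> U < \<rho> V)"

definition bounded_length :: "('a, 'r) ring_scheme \<Rightarrow> ('a, 'm) module \<Rightarrow> bool" where
  "bounded_length R M \<longleftrightarrow> (\<exists>\<rho>. submodule_rank R M (carrier M) \<rho>)"

text \<open>A submodule \<open>U\<close> of \<open>xR + N\<close> is controlled by \<open>U \<inter> N\<close> and the right ideal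
  \<open>J\<^sub>U = {a. xa \<in> U + N}\<close>: if \<open>U \<subseteq> V\<close> have the same intersection with \<open>N\<close> and the same right ideal,
  then every \<open>v \<in> V\<close> differs from an element of \<open>U\<close> by an element of \<open>V \<inter> N\<close>, so \<open>U = V\<close>.
  Therefore the ranks of the two add up to a rank on \<open>xR + N\<close>.\<close>

lemma submodule_rank_add_cyclic:
  assumes M: "right_module R M" and N: "submodule N R M" and x: "x \<in> carrier M"
    and \<rho>0: "submodule_rank R (regular_module R) (carrier R) \<rho>0"
    and \<rho>: "submodule_rank R M N \<rho>"
  shows "submodule_rank R M {a \<odot>\<^bsub>M\<^esub> x \<oplus>\<^bsub>M\<^esub> y | a y. a \<in> carrier R \<and> y \<in> N}
    (\<lambda>U. \<rho> (U \<inter> N) + \<rho>0 {a \<in> carrier R. \<exists>y\<in>N. a \<odot>\<^bsub>M\<^esub> x \<oplus>\<^bsub>M\<^esub> y \<in> U})"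
proof -
  interpret M: right_module R M by fact
  let ?J = "\<lambda>U. {a \<in> carrier R. \<exists>y\<in>N. a \<odot>\<^bsub>M\<^esub> x \<oplus>\<^bsub>M\<^esub> y \<in> U}"
  have NM: "y \<in> carrier M" if "y \<in> N" for y using that N by (auto simp: submodule_iff[OF M])
  have N': "\<zero>\<^bsub>M\<^esub> \<in> N" "\<And>x y. x \<in> N \<Longrightarrow> y \<in> N \<Longrightarrow> x \<oplus>\<^bsub>M\<^esub> y \<in> N"
    "\<And>a x. a \<in> carrier R \<Longrightarrow> x \<in> N \<Longrightarrow> a \<odot>\<^bsub>M\<^esub> x \<in> N"
    using N by (auto simp: submodule_iff[OF M])
  have J: "submodule (?J U) R (regular_module R)" if U: "submodule U R M" for U
    unfolding submodule_regular_iff[OF M.R.ring_axioms]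
  proof (intro conjI ballI)
    have U': "\<zero>\<^bsub>M\<^esub> \<in> U" "\<And>x y. x \<in> U \<Longrightarrow> y \<in> U \<Longrightarrow> x \<oplus>\<^bsub>M\<^esub> y \<in> U"
      "\<And>a x. a \<in> carrier R \<Longrightarrow> x \<in> U \<Longrightarrow> a \<odot>\<^bsub>M\<^esub> x \<in> U"
      using U by (auto simp: submodule_iff[OF M])
    show "\<zero>\<^bsub>R\<^esub> \<in> ?J U" using x N' U' by (auto simp: M.zero_smult intro!: bexI[of _ "\<zero>\<^bsub>M\<^esub>"])
    fix a assume a: "a \<in> ?J U"
    then obtain y where y: "y \<in> N" "a \<odot>\<^bsub>M\<^esub> x \<oplus>\<^bsub>M\<^esub> y \<in> U" and aR: "a \<in> carrier R" by auto
    {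
      fix b assume "b \<in> ?J U"
      then obtain z where z: "z \<in> N" "b \<odot>\<^bsub>M\<^esub> x \<oplus>\<^bsub>M\<^esub> z \<in> U" and bR: "b \<in> carrier R" by auto
      have "(a \<oplus>\<^bsub>R\<^esub> b) \<odot>\<^bsub>M\<^esub> x \<oplus>\<^bsub>M\<^esub> (y \<oplus>\<^bsub>M\<^esub> z)
          = (a \<odot>\<^bsub>M\<^esub> x \<oplus>\<^bsub>M\<^esub> y) \<oplus>\<^bsub>M\<^esub> (b \<odot>\<^bsub>M\<^esub> x \<oplus>\<^bsub>M\<^esub> z)"
        using aR bR x y z by (simp add: NM M.smult_l_distr M.smult_closed M.M.add.m_ac)
      also have "\<dots> \<in> U" using U' y z by auto
      finally show "a \<oplus>\<^bsub>R\<^esub> b \<in> ?J U" using aR bR y z N' by blast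
    }
    fix b assume b: "b \<in> carrier R"
    have "(a \<otimes>\<^bsub>R\<^esub> b) \<odot>\<^bsub>M\<^esub> x \<oplus>\<^bsub>M\<^esub> b \<odot>\<^bsub>M\<^esub> y = b \<odot>\<^bsub>M\<^esub> (a \<odot>\<^bsub>M\<^esub> x \<oplus>\<^bsub>M\<^esub> y)"
      using aR b x y by (simp add: NM M.smult_r_distr M.smult_closed M.smult_assoc)
    also have "\<dots> \<in> U" using U' y b by auto
    finally show "a \<otimes>\<^bsub>R\<^esub> b \<in> ?J U" using aR b y N' by blast
  qed auto
  show ?thesis unfolding submodule_rank_def
  proof (intro allI impI, elim conjE)
    fix U V assume U: "submodule U R M" and V: "submodule V R M" and UV: "U \<subset> V"
      and VN: "V \<subseteq> {a \<odot>\<^bsub>M\<^esub> x \<oplus>\<^bsub>M\<^esub> y | a y. a \<in> carrier R \<and> y \<in> N}"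
    have rank_N: "\<rho> (U \<inter> N) < \<rho> (V \<inter> N)" if "U \<inter> N \<noteq> V \<inter> N"
    proof -
      have "U \<inter> N \<subset> V \<inter> N" using that UV by auto
      then show ?thesis
        using \<rho> submodule_Int[OF M U N] submodule_Int[OF M V N] unfolding submodule_rank_def by blast
    qed
    have rank_J: "\<rho>0 (?J U) < \<rho>0 (?J V)" if "?J U \<noteq> ?J V"
    proof -
      have "?J U \<subset> ?J V" using that UV by auto
      then show ?thesis using \<rho>0 J[OF U] J[OF V] unfolding submodule_rank_def by blast
    qed
    have "U = V" if eq: "U \<inter> N = V \<inter> N" "?J U = ?J V"
    proof
      show "V \<subseteq> U"
      proof
        fix v assume v: "v \<in> V"
        then obtain a y where ay: "v = a \<odot>\<^bsub>M\<^esub> x \<oplus>\<^bsub>M\<^esub> y" "a \<in> carrier R" "y \<in> N" using VN by blast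
        then have "a \<in> ?J U" using v eq by blast
        then obtain z where z: "z \<in> N" "a \<odot>\<^bsub>M\<^esub> x \<oplus>\<^bsub>M\<^esub> z \<in> U" by auto
        have vz: "v \<ominus>\<^bsub>M\<^esub> (a \<odot>\<^bsub>M\<^esub> x \<oplus>\<^bsub>M\<^esub> z) \<in> V" using v z UV by (intro submodule_diff[OF M V]) auto
        have "v \<ominus>\<^bsub>M\<^esub> (a \<odot>\<^bsub>M\<^esub> x \<oplus>\<^bsub>M\<^esub> z) = y \<ominus>\<^bsub>M\<^esub> z"
        proof -
          have "a \<odot>\<^bsub>M\<^esub> x \<oplus>\<^bsub>M\<^esub> (y \<oplus>\<^bsub>M\<^esub> (\<ominus>\<^bsub>M\<^esub> (a \<odot>\<^bsub>M\<^esub> x) \<oplus>\<^bsub>M\<^esub> \<ominus>\<^bsub>M\<^esub> z))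
              = (a \<odot>\<^bsub>M\<^esub> x \<oplus>\<^bsub>M\<^esub> \<ominus>\<^bsub>M\<^esub> (a \<odot>\<^bsub>M\<^esub> x)) \<oplus>\<^bsub>M\<^esub> (y \<oplus>\<^bsub>M\<^esub> \<ominus>\<^bsub>M\<^esub> z)"
            using ay z x by (simp add: NM M.smult_closed M.M.add.m_ac)
          then show ?thesis using ay z x
            by (simp add: NM M.smult_closed M.M.minus_eq M.M.minus_add M.M.a_assoc M.M.r_neg)
        qed
        moreover have "y \<ominus>\<^bsub>M\<^esub> z \<in> N" using ay z by (intro submodule_diff[OF M N])
        ultimately have "v \<ominus>\<^bsub>M\<^esub> (a \<odot>\<^bsub>M\<^esub> x \<oplus>\<^bsub>M\<^esub> z) \<in> U" using vz eq by auto
        then have "(v \<ominus>\<^bsub>M\<^esub> (a \<odot>\<^bsub>M\<^esub> x \<oplus>\<^bsub>M\<^esub> z)) \<oplus>\<^bsub>M\<^esub> (a \<odot>\<^bsub>M\<^esub> x \<oplus>\<^bsub>M\<^esub> z) \<in> U"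
          using z U by (simp add: submodule_iff[OF M])
        then show "v \<in> U" using ay z x by (simp add: NM M.smult_closed M.M.diff_add_cancel)
      qed
    qed (use UV in auto)
    then consider "U \<inter> N \<noteq> V \<inter> N" | "?J U \<noteq> ?J V" using UV by blast
    then show "\<rho> (U \<inter> N) + \<rho>0 (?J U) < \<rho> (V \<inter> N) + \<rho>0 (?J V)"
    proof cases
      case 1
      then show ?thesis using rank_N rank_J by (cases "?J U = ?J V") force+
    next
      case 2
      then show ?thesis using rank_N rank_J by (cases "U \<inter> N = V \<inter> N") force+
    qed
  qed
qed

lemma bounded_length_fg:
  assumes M: "right_module R M" and fg: "finitely_generated R M"
    and R: "bounded_length R (regular_module R)"
  shows "bounded_length R M"
proof -
  interpret M: right_module R M by fact
  obtain \<rho>0 where \<rho>0: "submodule_rank R (regular_module R) (carrier R) \<rho>0"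
    using R by (auto simp: bounded_length_def regular_module_def)
  have *: "\<exists>N \<rho>. submodule N R M \<and> B \<subseteq> N \<and> submodule_rank R M N \<rho>"
    if "finite B" "B \<subseteq> carrier M" for B
    using that
  proof (induction B)
    case empty
    have "submodule_rank R M {\<zero>\<^bsub>M\<^esub>} (\<lambda>_. 0)"
      by (auto simp: submodule_rank_def submodule_iff[OF M])
    then show ?case using submodule_zero[OF M] by blast
  next
    case (insert x B)
    then obtain N \<rho> where N: "submodule N R M" "B \<subseteq> N" "submodule_rank R M N \<rho>" by auto
    have x: "x \<in> carrier M" using insert by auto
    have NM: "y \<in> carrier M" if "y \<in> N" for y using that N by (auto simp: submodule_iff[OF M])
    let ?N = "{a \<odot>\<^bsub>M\<^esub> x \<oplus>\<^bsub>M\<^esub> y | a y. a \<in> carrier R \<and> y \<in> N}"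
    have "x = \<one>\<^bsub>R\<^esub> \<odot>\<^bsub>M\<^esub> x \<oplus>\<^bsub>M\<^esub> \<zero>\<^bsub>M\<^esub>" using x by (simp add: M.smult_one)
    moreover have "\<zero>\<^bsub>M\<^esub> \<in> N" using N by (simp add: submodule_iff[OF M])
    ultimately have "x \<in> ?N" by blast
    moreover have "y \<in> ?N" if "y \<in> N" for y
    proof -
      have "y = \<zero>\<^bsub>R\<^esub> \<odot>\<^bsub>M\<^esub> x \<oplus>\<^bsub>M\<^esub> y" using x NM[OF that] by (simp add: M.zero_smult)
      then show ?thesis using that by blast
    qed
    ultimately have "insert x B \<subseteq> ?N" using N(2) by blast
    then show ?case
      using M.submodule_add_cyclic[OF N(1) x] submodule_rank_add_cyclic[OF M N(1) x \<rho>0 N(3)] by blast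
  qed
  obtain B where B: "finite B" "B \<subseteq> carrier M" "generated_submodule R M B = carrier M"
    using fg unfolding finitely_generated_def by blast
  from *[OF B(1,2)] obtain N \<rho> where N: "submodule N R M" "B \<subseteq> N" "submodule_rank R M N \<rho>" by blast
  have "carrier M \<subseteq> N" using generated_submodule_least[OF N(1,2)] B(3) by simp
  then have "submodule_rank R M (carrier M) \<rho>" using N(3) unfolding submodule_rank_def by blast
  then show ?thesis by (auto simp: bounded_length_def)
qed

lemma bounded_length_field:
  assumes "field K"
  shows "bounded_length K (regular_module K)"
proof -
  interpret field K by fact
  have "submodule_rank K (regular_module K) (carrier K) (\<lambda>U. if U \<subseteq> {\<zero>\<^bsub>K\<^esub>} then 0 else 1)"
    unfolding submodule_rank_def submodule_regular_iff[OF ring_axioms]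
  proof (intro allI impI, elim conjE)
    fix U V assume U: "U \<subseteq> carrier K" "\<forall>a\<in>carrier K. \<forall>x\<in>U. x \<otimes>\<^bsub>K\<^esub> a \<in> U" "\<zero>\<^bsub>K\<^esub> \<in> U"
      and V: "V \<subseteq> carrier K" "U \<subset> V"
    have "U \<subseteq> {\<zero>\<^bsub>K\<^esub>}"
    proof (rule ccontr)
      assume "\<not> U \<subseteq> {\<zero>\<^bsub>K\<^esub>}"
      then obtain u where u: "u \<in> U" "u \<noteq> \<zero>\<^bsub>K\<^esub>" by auto
      have "b \<in> U" if b: "b \<in> carrier K" for b
      proof -
        have uu: "u \<in> Units K" using u U field_Units by auto
        then have "u \<otimes>\<^bsub>K\<^esub> (inv\<^bsub>K\<^esub> u \<otimes>\<^bsub>K\<^esub> b) = b" using b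
          by (simp add: m_assoc[symmetric] Units_closed Units_r_inv)
        then show ?thesis using U u uu b by (metis Units_inv_closed m_closed)
      qed
      then show False using V by blast
    qed
    moreover then have "\<not> V \<subseteq> {\<zero>\<^bsub>K\<^esub>}" using U V by blast
    ultimately show "(if U \<subseteq> {\<zero>\<^bsub>K\<^esub>} then 0 else 1) < (if V \<subseteq> {\<zero>\<^bsub>K\<^esub>} then 0 else (1::nat))" by simp
  qed
  then show ?thesis unfolding bounded_length_def by (auto simp: regular_module_def)
qed

text \<open>Right ideals are \<open>K\<close>-subspaces, because \<open>c x = x (c 1)\<close>; and a finite-dimensional space has bounded
  length by the case of the field \<open>K\<close> itself.\<close>

lemma bounded_length_algebra:
  assumes "finite_dimensional_algebra K A"
  shows "bounded_length A (regular_module A)"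
proof -
  have A: "field_algebra K A" using assms by (simp add: finite_dimensional_algebra_def)
  interpret K: field K by (rule field_algebra.field[OF A])
  interpret A: field_algebra K A by (rule A)
  interpret AR: ring A by (rule A.ring)
  have M: "right_module K A"
    by (intro right_module.intro right_module_axioms.intro K.ring_axioms ring.axioms(1)[OF A.ring])
      (simp_all add: A.smult_l_distr A.smult_r_distr A.smult_assoc1[symmetric] K.m_comm)
  obtain \<rho> where \<rho>: "submodule_rank K A (carrier A) \<rho>"
    using bounded_length_fg[OF M _ bounded_length_field[OF A.field]] assms
    by (auto simp: finite_dimensional_algebra_def bounded_length_def)
  have "submodule J K A" if J: "submodule J A (regular_module A)" for J
    unfolding submodule_iff[OF M]
  proof (intro conjI ballI)
    fix c x assume c: "c \<in> carrier K" and x: "x \<in> J"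
    have xA: "x \<in> carrier A" using J x by (auto simp: submodule_regular_iff[OF A.ring])
    have "c \<odot>\<^bsub>A\<^esub> x = x \<otimes>\<^bsub>A\<^esub> (c \<odot>\<^bsub>A\<^esub> \<one>\<^bsub>A\<^esub>)"
      using A.smult_mult_right[OF c xA AR.one_closed] xA by simp
    then show "c \<odot>\<^bsub>A\<^esub> x \<in> J" using J x c by (simp add: submodule_regular_iff[OF A.ring])
  qed (use J in \<open>auto simp: submodule_regular_iff[OF A.ring]\<close>)
  then have "submodule_rank A (regular_module A) (carrier A) \<rho>"
    using \<rho> unfolding submodule_rank_def by blast
  then show ?thesis unfolding bounded_length_def by (auto simp: regular_module_def)
qed

lemma generated_submodule_in_submodule:
  assumes M: "right_module R M" and N: "submodule N R M" and "U \<subseteq> N"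
  shows "generated_submodule R (M\<lparr>carrier := N\<rparr>) U = generated_submodule R M U"
proof
  have UM: "U \<subseteq> carrier M" using assms by (auto simp: submodule_iff)
  show "generated_submodule R (M\<lparr>carrier := N\<rparr>) U \<subseteq> generated_submodule R M U"
    using assms generated_submodule_least[OF N \<open>U \<subseteq> N\<close>] submodule_generated[OF M UM]
      generated_submodule_superset[of U R M]
    by (intro generated_submodule_least) (auto simp: submodule_submodule_iff)
  have "submodule (generated_submodule R (M\<lparr>carrier := N\<rparr>) U) R (M\<lparr>carrier := N\<rparr>)"
    using assms by (intro submodule_generated right_module_submodule) auto
  then show "generated_submodule R M U \<subseteq> generated_submodule R (M\<lparr>carrier := N\<rparr>) U"
    by (intro generated_submodule_least generated_submodule_superset)
      (auto simp: submodule_submodule_iff[OF M N])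
qed

lemma submodule_rank_le:
  assumes "submodule_rank R M N \<rho>" "submodule U R M" "submodule V R M" "U \<subseteq> V" "V \<subseteq> N"
  shows "\<rho> U \<le> \<rho> V"
proof (cases "U = V")
  case False
  then have "U \<subset> V" using assms by auto
  then show ?thesis using assms unfolding submodule_rank_def by (blast intro: less_imp_le)
qed simp

text \<open>A finitely generated submodule of \<open>N\<close> of largest rank cannot be enlarged by a further
  generator, so it is \<open>N\<close>.\<close>

lemma fg_submodule:
  assumes M: "right_module R M" and len: "bounded_length R M" and N: "submodule N R M"
  shows "finitely_generated R (M\<lparr>carrier := N\<rparr>)"
proof -
  obtain \<rho> where \<rho>: "submodule_rank R M (carrier M) \<rho>" using len by (auto simp: bounded_length_def)
  let ?gen = "generated_submodule R M"
  have NM: "N \<subseteq> carrier M" using N by (simp add: submodule_iff[OF M])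
  have gen: "submodule (?gen U) R M" "?gen U \<subseteq> N" if "U \<subseteq> N" for U
    using submodule_generated[OF M] generated_submodule_least[OF N that] that NM by auto
  obtain U where U: "finite U" "U \<subseteq> N"
    and max: "\<And>V. finite V \<Longrightarrow> V \<subseteq> N \<Longrightarrow> \<rho> (carrier M) - \<rho> (?gen U) \<le> \<rho> (carrier M) - \<rho> (?gen V)"
    \<comment> \<open>maximal rank, as minimal distance from the rank of the whole module\<close>
    using ex_has_least_nat[of "\<lambda>U. finite U \<and> U \<subseteq> N" "{}" "\<lambda>U. \<rho> (carrier M) - \<rho> (?gen U)"] by auto
  have "?gen U = N"
  proof (rule ccontr)
    assume "?gen U \<noteq> N"
    then obtain x where x: "x \<in> N" "x \<notin> ?gen U" using gen(2)[OF U(2)] by auto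
    have V: "finite (insert x U)" "insert x U \<subseteq> N" using U x by auto
    have "?gen U \<subseteq> ?gen (insert x U)"
      using generated_submodule_superset[of "insert x U" R M] gen[OF V(2)]
      by (intro generated_submodule_least) auto
    moreover have "x \<in> ?gen (insert x U)" using generated_submodule_superset[of "insert x U" R M] by auto
    ultimately have "?gen U \<subset> ?gen (insert x U)" using x by auto
    then have "\<rho> (?gen U) < \<rho> (?gen (insert x U))"
      using \<rho> gen[OF V(2)] gen[OF U(2)] NM unfolding submodule_rank_def by blast
    moreover have "\<rho> (?gen (insert x U)) \<le> \<rho> (carrier M)"
      using gen[OF V(2)] NM by (intro submodule_rank_le[OF \<rho>] submodule_carrier[OF M]) auto
    ultimately show False using max[OF V] by linarith
  qed
  then show ?thesis unfolding finitely_generated_def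
    using U generated_submodule_in_submodule[OF M N U(2)] by (intro exI[of _ U]) simp
qed

lemma exists_simple_submodule:
  assumes M: "right_module R M" and len: "bounded_length R M"
    and N: "submodule N R M" "N \<noteq> {\<zero>\<^bsub>M\<^esub>}"
  shows "\<exists>S. simple_submodule S R M \<and> S \<subseteq> N"
proof -
  obtain \<rho> where \<rho>: "submodule_rank R M (carrier M) \<rho>" using len by (auto simp: bounded_length_def)
  obtain S where S: "submodule S R M" "S \<noteq> {\<zero>\<^bsub>M\<^esub>}" "S \<subseteq> N"
    and min: "\<And>T. submodule T R M \<Longrightarrow> T \<noteq> {\<zero>\<^bsub>M\<^esub>} \<Longrightarrow> T \<subseteq> N \<Longrightarrow> \<rho> S \<le> \<rho> T"
    using ex_has_least_nat[of "\<lambda>S. submodule S R M \<and> S \<noteq> {\<zero>\<^bsub>M\<^esub>} \<and> S \<subseteq> N" N \<rho>] N by auto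
  have "T = {\<zero>\<^bsub>M\<^esub>} \<or> T = S" if T: "submodule T R M" "T \<subseteq> S" for T
  proof (rule ccontr)
    assume *: "\<not> (T = {\<zero>\<^bsub>M\<^esub>} \<or> T = S)"
    then have "\<rho> T < \<rho> S"
      using \<rho> S T unfolding submodule_rank_def by (auto simp: submodule_iff[OF M] psubset_eq)
    moreover have "\<rho> S \<le> \<rho> T" using min T * S by auto
    ultimately show False by simp
  qed
  then show ?thesis using S unfolding simple_submodule_def by blast
qed

text \<open>A nonzero submodule of least rank inside a given one is simple, so every nonzero submodule meets
  the socle.\<close>

lemma socle_essential:
  assumes M: "right_module R M" and len: "bounded_length R M"
  shows "essential_submodule (carrier (socle R M)) R M"
  unfolding essential_submodule_def
proof (intro conjI allI impI)
  let ?U = "\<Union>{S. simple_submodule S R M}"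
  have "?U \<subseteq> carrier M" by (auto simp: simple_submodule_def submodule_iff[OF M])
  then show soc: "submodule (carrier (socle R M)) R M"
    by (simp add: socle_def submodule_generated[OF M])
  fix N assume N: "submodule N R M \<and> N \<noteq> {\<zero>\<^bsub>M\<^esub>}"
  then obtain S where S: "simple_submodule S R M" "S \<subseteq> N"
    using exists_simple_submodule[OF M len] by blast
  have "S \<subseteq> carrier (socle R M)"
    using S generated_submodule_superset[of ?U R M] by (auto simp: socle_def)
  moreover have "\<zero>\<^bsub>M\<^esub> \<in> S" "S \<noteq> {\<zero>\<^bsub>M\<^esub>}" using S by (auto simp: simple_submodule_def submodule_iff[OF M])
  ultimately show "N \<inter> carrier (socle R M) \<noteq> {\<zero>\<^bsub>M\<^esub>}" using S by blast
qed

section \<open>Homomorphisms from projective and into injective modules\<close>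

lemma fg_modules_right_module: "M \<in> fg_modules R \<Longrightarrow> right_module R M"
  by (simp add: fg_modules_def)

lemma fg_image:
  assumes M: "M \<in> fg_modules R" and L: "right_module R L"
    and f: "f \<in> module_hom R M L" "f ` carrier M = carrier L"
  shows "L \<in> fg_modules R"
proof -
  have rM: "right_module R M" using M by (rule fg_modules_right_module)
  obtain B where B: "finite B" "B \<subseteq> carrier M" "generated_submodule R M B = carrier M"
    using M unfolding fg_modules_def finitely_generated_def by blast
  have fB: "f ` B \<subseteq> carrier L" using f B by auto
  let ?G = "generated_submodule R L (f ` B)"
  have G: "submodule ?G R L" by (rule submodule_generated[OF L fB])
  have "generated_submodule R M B \<subseteq> {x \<in> carrier M. f x \<in> ?G}"
    using B generated_submodule_superset[of "f ` B" R L]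
    by (intro generated_submodule_least submodule_vimage[OF rM L f(1) G]) auto
  then have "f ` carrier M \<subseteq> ?G" using B(3) by auto
  then have "carrier L \<subseteq> ?G" by (simp only: f(2))
  moreover have "?G \<subseteq> carrier L" using G by (simp add: submodule_iff[OF L])
  ultimately have "?G = carrier L" by auto
  then have "finitely_generated R L"
    unfolding finitely_generated_def using B fB by (intro exI[of _ "f ` B"]) auto
  then show ?thesis using L by (simp add: fg_modules_def)
qed

text \<open>Projectivity and injectivity are tested on modules of lists only.  Passing through an
  isomorphic copy frees the lifting and extension properties below from this restriction.\<close>

lemma fg_list_copy:
  fixes M :: "('a, 'm) module"
  assumes "M \<in> fg_modules R"
  obtains N :: "('a, 'a list) module" and f g
  where "N \<in> fg_modules R" "f \<in> module_hom R M N" "g \<in> module_hom R N M"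
    "\<And>x. x \<in> carrier M \<Longrightarrow> g (f x) = x" "\<And>y. y \<in> carrier N \<Longrightarrow> f (g y) = y"
proof -
  obtain N :: "('a, 'a list) module" and f where N: "N \<in> fg_modules R"
    and f: "f \<in> module_hom R M N" "bij_betw f (carrier M) (carrier N)"
    using fg_modules_list_copy[OF assms] unfolding module_isomorphic_def by blast
  note g = hom_inv[OF f fg_modules_right_module[OF assms] fg_modules_right_module[OF N]]
  show thesis
    using f(2) by (intro that[OF N f(1) g(1)]) (simp_all add: bij_betw_def f_inv_into_f)
qed

lemma projective_lift:
  assumes P: "projective_module R P" and N: "N \<in> fg_modules R" and L: "L \<in> fg_modules R"
    and g: "g \<in> module_hom R N L" "g ` carrier N = carrier L" and f: "f \<in> module_hom R P L"
  obtains h where "h \<in> module_hom R P N" "\<And>x. x \<in> carrier P \<Longrightarrow> g (h x) = f x"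
proof -
  obtain N' :: "('a, 'a list) module" and \<alpha> \<alpha>' where N': "N' \<in> fg_modules R"
    and \<alpha>: "\<alpha> \<in> module_hom R N N'" "\<alpha>' \<in> module_hom R N' N"
    "\<And>x. x \<in> carrier N \<Longrightarrow> \<alpha>' (\<alpha> x) = x" "\<And>x. x \<in> carrier N' \<Longrightarrow> \<alpha> (\<alpha>' x) = x"
    using fg_list_copy[OF N] by metis
  obtain L' :: "('a, 'a list) module" and \<beta> \<beta>' where L': "L' \<in> fg_modules R"
    and \<beta>: "\<beta> \<in> module_hom R L L'" "\<beta>' \<in> module_hom R L' L"
    "\<And>x. x \<in> carrier L \<Longrightarrow> \<beta>' (\<beta> x) = x" "\<And>x. x \<in> carrier L' \<Longrightarrow> \<beta> (\<beta>' x) = x"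
    using fg_list_copy[OF L] by metis
  let ?g = "\<lambda>x. \<beta> (g (\<alpha>' x))"
  have g': "?g \<in> module_hom R N' L'" by (intro hom_comp[OF _ \<beta>(1)] hom_comp[OF \<alpha>(2) g(1)])
  have f': "(\<lambda>x. \<beta> (f x)) \<in> module_hom R P L'" by (intro hom_comp[OF f \<beta>(1)])
  have "carrier L' \<subseteq> ?g ` carrier N'"
  proof
    fix y assume y: "y \<in> carrier L'"
    then have "\<beta>' y \<in> carrier L" by (rule hom_closed[OF \<beta>(2)])
    then obtain x where x: "x \<in> carrier N" "g x = \<beta>' y" using g(2) by (metis imageE)
    then have "?g (\<alpha> x) = y" using \<alpha> \<beta> y by simp
    then show "y \<in> ?g ` carrier N'" using hom_closed[OF \<alpha>(1) x(1)] by blast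
  qed
  then have surj: "?g ` carrier N' = carrier L'" using hom_closed[OF g'] by auto
  obtain h where h: "h \<in> module_hom R P N'" "\<forall>x\<in>carrier P. ?g (h x) = \<beta> (f x)"
    using P[unfolded projective_module_def, rule_format, OF N' L' g' f' surj] by blast
  show thesis
  proof (rule that[of "\<lambda>x. \<alpha>' (h x)"])
    show "(\<lambda>x. \<alpha>' (h x)) \<in> module_hom R P N" by (rule hom_comp[OF h(1) \<alpha>(2)])
    fix x assume x: "x \<in> carrier P"
    have "\<beta>' (\<beta> (g (\<alpha>' (h x)))) = \<beta>' (\<beta> (f x))" using h(2) x by simp
    then show "g (\<alpha>' (h x)) = f x"
      using \<beta>(3) hom_closed[OF f x] hom_closed[OF g(1) hom_closed[OF \<alpha>(2) hom_closed[OF h(1) x]]]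
      by simp
  qed
qed

lemma projective_section:
  assumes "projective_module R P" "P \<in> fg_modules R" "N \<in> fg_modules R"
    and "g \<in> module_hom R N P" "g ` carrier N = carrier P"
  obtains s where "s \<in> module_hom R P N" "\<And>x. x \<in> carrier P \<Longrightarrow> g (s x) = x"
  using projective_lift[OF assms(1,3,2,4,5) hom_id] by blast

lemma injective_extend:
  assumes I: "injective_module R I" and N: "N \<in> fg_modules R" and L: "L \<in> fg_modules R"
    and g: "g \<in> module_hom R N L" "inj_on g (carrier N)" and f: "f \<in> module_hom R N I"
  obtains h where "h \<in> module_hom R L I" "\<And>x. x \<in> carrier N \<Longrightarrow> h (g x) = f x"
proof -
  obtain N' :: "('a, 'a list) module" and \<alpha> \<alpha>' where N': "N' \<in> fg_modules R"
    and \<alpha>: "\<alpha> \<in> module_hom R N N'" "\<alpha>' \<in> module_hom R N' N"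
    "\<And>x. x \<in> carrier N \<Longrightarrow> \<alpha>' (\<alpha> x) = x" "\<And>x. x \<in> carrier N' \<Longrightarrow> \<alpha> (\<alpha>' x) = x"
    using fg_list_copy[OF N] by metis
  obtain L' :: "('a, 'a list) module" and \<beta> \<beta>' where L': "L' \<in> fg_modules R"
    and \<beta>: "\<beta> \<in> module_hom R L L'" "\<beta>' \<in> module_hom R L' L"
    "\<And>x. x \<in> carrier L \<Longrightarrow> \<beta>' (\<beta> x) = x" "\<And>x. x \<in> carrier L' \<Longrightarrow> \<beta> (\<beta>' x) = x"
    using fg_list_copy[OF L] by metis
  let ?g = "\<lambda>x. \<beta> (g (\<alpha>' x))"
  have g': "?g \<in> module_hom R N' L'" by (intro hom_comp[OF _ \<beta>(1)] hom_comp[OF \<alpha>(2) g(1)])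
  have f': "(\<lambda>x. f (\<alpha>' x)) \<in> module_hom R N' I" by (intro hom_comp[OF \<alpha>(2) f])
  have inj: "inj_on ?g (carrier N')"
  proof (rule inj_onI)
    fix x y assume xy: "x \<in> carrier N'" "y \<in> carrier N'" "?g x = ?g y"
    note c = hom_closed[OF \<alpha>(2) xy(1)] hom_closed[OF \<alpha>(2) xy(2)]
    have "g (\<alpha>' x) = g (\<alpha>' y)"
      using arg_cong[OF xy(3), of \<beta>'] unfolding \<beta>(3)[OF hom_closed[OF g(1) c(1)]]
        \<beta>(3)[OF hom_closed[OF g(1) c(2)]] .
    then have "\<alpha>' x = \<alpha>' y" using g(2) c by (simp add: inj_on_def)
    then show "x = y" using \<alpha>(4) xy by metis
  qed
  obtain h where h: "h \<in> module_hom R L' I" "\<forall>x\<in>carrier N'. h (?g x) = f (\<alpha>' x)"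
    using I[unfolded injective_module_def, rule_format, OF N' L' g' f' inj] by blast
  show thesis
  proof (rule that[of "\<lambda>x. h (\<beta> x)"])
    show "(\<lambda>x. h (\<beta> x)) \<in> module_hom R L I" by (rule hom_comp[OF \<beta>(1) h(1)])
    fix x assume x: "x \<in> carrier N"
    then show "h (\<beta> (g x)) = f x" using h(2) hom_closed[OF \<alpha>(1) x] \<alpha>(3) by force
  qed
qed

lemma injective_extend_submodule:
  assumes I: "injective_module R I" and M: "M \<in> fg_modules R" "M\<lparr>carrier := N\<rparr> \<in> fg_modules R"
    and N: "N \<subseteq> carrier M" and f: "f \<in> module_hom R (M\<lparr>carrier := N\<rparr>) I"
  obtains h where "h \<in> module_hom R M I" "\<And>x. x \<in> N \<Longrightarrow> h x = f x"
proof -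
  have "(\<lambda>x. x) \<in> module_hom R (M\<lparr>carrier := N\<rparr>) M" by (rule hom_restrict[OF hom_id N])
  moreover have "inj_on (\<lambda>x. x) (carrier (M\<lparr>carrier := N\<rparr>))" by simp
  ultimately obtain h where h: "h \<in> module_hom R M I"
    "\<And>x. x \<in> carrier (M\<lparr>carrier := N\<rparr>) \<Longrightarrow> h x = f x"
    using injective_extend[OF I M(2,1) _ _ f] by blast
  show thesis by (rule that[OF h(1)]) (simp add: h(2))
qed

section \<open>Quotients and biproducts\<close>

lemma hom_factor:
  assumes P: "right_module R P" and N: "right_module R N" and L: "right_module R L"
    and p: "p \<in> module_hom R P N" "p ` carrier P = carrier N" and g: "g \<in> module_hom R P L"
    and ker: "\<And>x. x \<in> carrier P \<Longrightarrow> p x = \<zero>\<^bsub>N\<^esub> \<Longrightarrow> g x = \<zero>\<^bsub>L\<^esub>"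
  obtains h where "h \<in> module_hom R N L" "\<And>x. x \<in> carrier P \<Longrightarrow> h (p x) = g x"
proof -
  interpret P: right_module R P by fact
  interpret N: right_module R N by fact
  interpret L: right_module R L by fact
  let ?s = "inv_into (carrier P) p"
  have s: "?s y \<in> carrier P" "p (?s y) = y" if "y \<in> carrier N" for y
    using that p(2) by (auto simp: inv_into_into f_inv_into_f)
  have eq: "g x = g y" if "x \<in> carrier P" "y \<in> carrier P" "p x = p y" for x y
  proof -
    have "p (x \<ominus>\<^bsub>P\<^esub> y) = \<zero>\<^bsub>N\<^esub>"
      using that hom_diff[OF P N p(1)] hom_closed[OF p(1)] by (simp add: N.M.diff_eq_zero_iff)
    then have "g (x \<ominus>\<^bsub>P\<^esub> y) = \<zero>\<^bsub>L\<^esub>" using that by (intro ker) simp_all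
    then show ?thesis
      using that hom_diff[OF P L g] hom_closed[OF g] by (simp add: L.M.diff_eq_zero_iff)
  qed
  show thesis
  proof (rule that[of "\<lambda>y. g (?s y)"])
    show "(\<lambda>y. g (?s y)) \<in> module_hom R N L"
    proof (rule module_homI)
      fix x y assume xy: "x \<in> carrier N" "y \<in> carrier N"
      have "g (?s (x \<oplus>\<^bsub>N\<^esub> y)) = g (?s x \<oplus>\<^bsub>P\<^esub> ?s y)"
        using xy s by (intro eq) (simp_all add: hom_add[OF p(1)])
      then show "g (?s (x \<oplus>\<^bsub>N\<^esub> y)) = g (?s x) \<oplus>\<^bsub>L\<^esub> g (?s y)"
        using xy s by (simp add: hom_add[OF g])
    next
      fix a x assume ax: "a \<in> carrier R" "x \<in> carrier N"
      have "g (?s (a \<odot>\<^bsub>N\<^esub> x)) = g (a \<odot>\<^bsub>P\<^esub> ?s x)"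
        using ax s by (intro eq) (simp_all add: hom_smult[OF p(1)] P.smult_closed N.smult_closed)
      then show "g (?s (a \<odot>\<^bsub>N\<^esub> x)) = a \<odot>\<^bsub>L\<^esub> g (?s x)"
        using ax s by (simp add: hom_smult[OF g])
    qed (use s hom_closed[OF g] in auto)
    fix x assume "x \<in> carrier P"
    then show "g (?s (p x)) = g x" using s hom_closed[OF p(1)] by (intro eq) auto
  qed
qed

text \<open>The quotient consists of one representative \<open>c x\<close> of each coset \<open>x + N\<close> rather than of the
  cosets themselves, which keeps the element type.\<close>

lemma exists_quotient:
  assumes M: "(M :: ('a, 'm) module) \<in> fg_modules R" and N: "submodule N R M"
  obtains L :: "('a, 'm) module" and \<pi> where "L \<in> fg_modules R" "\<pi> \<in> module_hom R M L"
    "\<pi> ` carrier M = carrier L" "a_kernel M L \<pi> = N"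
proof -
  have rM: "right_module R M" using M by (rule fg_modules_right_module)
  interpret M: right_module R M by (rule rM)
  have N': "\<zero>\<^bsub>M\<^esub> \<in> N" "\<And>x y. x \<in> N \<Longrightarrow> y \<in> N \<Longrightarrow> x \<oplus>\<^bsub>M\<^esub> y \<in> N"
    "\<And>a x. a \<in> carrier R \<Longrightarrow> x \<in> N \<Longrightarrow> a \<odot>\<^bsub>M\<^esub> x \<in> N" "\<And>x. x \<in> N \<Longrightarrow> x \<in> carrier M"
    using N by (auto simp: submodule_iff[OF rM])
  \<comment> \<open>c x depends on the coset of x only, see c_shift\<close>
  define c where "c x = (SOME y. y \<in> carrier M \<and> (\<exists>n\<in>N. y = x \<oplus>\<^bsub>M\<^esub> n))" for x
  have c: "c x \<in> carrier M" "\<exists>n\<in>N. c x = x \<oplus>\<^bsub>M\<^esub> n" if "x \<in> carrier M" for x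
  proof -
    have "x \<in> carrier M \<and> (\<exists>n\<in>N. x = x \<oplus>\<^bsub>M\<^esub> n)" using that N'(1) by force
    then have "c x \<in> carrier M \<and> (\<exists>n\<in>N. c x = x \<oplus>\<^bsub>M\<^esub> n)" unfolding c_def by (rule someI)
    then show "c x \<in> carrier M" "\<exists>n\<in>N. c x = x \<oplus>\<^bsub>M\<^esub> n" by auto
  qed
  have c_shift: "c (x \<oplus>\<^bsub>M\<^esub> n) = c x" if x: "x \<in> carrier M" and n: "n \<in> N" for x n
  proof -
    have "(\<exists>m\<in>N. y = (x \<oplus>\<^bsub>M\<^esub> n) \<oplus>\<^bsub>M\<^esub> m) \<longleftrightarrow> (\<exists>m\<in>N. y = x \<oplus>\<^bsub>M\<^esub> m)" for y
    proof
      assume "\<exists>m\<in>N. y = (x \<oplus>\<^bsub>M\<^esub> n) \<oplus>\<^bsub>M\<^esub> m"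
      then show "\<exists>m\<in>N. y = x \<oplus>\<^bsub>M\<^esub> m" using x n N' by (metis M.M.a_assoc)
    next
      assume "\<exists>m\<in>N. y = x \<oplus>\<^bsub>M\<^esub> m"
      then obtain m where m: "m \<in> N" "y = x \<oplus>\<^bsub>M\<^esub> m" by auto
      have "y = (x \<oplus>\<^bsub>M\<^esub> n) \<oplus>\<^bsub>M\<^esub> (m \<ominus>\<^bsub>M\<^esub> n)"
      proof -
        have "(x \<oplus>\<^bsub>M\<^esub> n) \<oplus>\<^bsub>M\<^esub> (m \<ominus>\<^bsub>M\<^esub> n) = x \<oplus>\<^bsub>M\<^esub> ((m \<ominus>\<^bsub>M\<^esub> n) \<oplus>\<^bsub>M\<^esub> n)"
          using x n m N' by (simp add: M.M.a_ac)
        then show ?thesis using x n m N' by (simp add: M.M.diff_add_cancel)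
      qed
      then show "\<exists>m\<in>N. y = (x \<oplus>\<^bsub>M\<^esub> n) \<oplus>\<^bsub>M\<^esub> m"
        using submodule_diff[OF rM N m(1) n] by blast
    qed
    then show ?thesis by (simp add: c_def)
  qed
  have c_zero: "x \<in> N" if x: "x \<in> carrier M" "c x = c \<zero>\<^bsub>M\<^esub>" for x
  proof -
    obtain n m where nm: "n \<in> N" "m \<in> N" "c x = x \<oplus>\<^bsub>M\<^esub> n" "c \<zero>\<^bsub>M\<^esub> = \<zero>\<^bsub>M\<^esub> \<oplus>\<^bsub>M\<^esub> m"
      using c(2)[OF x(1)] c(2)[OF M.M.zero_closed] by blast
    then have "x \<oplus>\<^bsub>M\<^esub> n = m" using x N' by simp
    then have "x = m \<ominus>\<^bsub>M\<^esub> n" using x(1) nm N' M.M.add_diff_cancel by metis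
    then show ?thesis using submodule_diff[OF rM N] nm by simp
  qed
  have c_add: "c (c x \<oplus>\<^bsub>M\<^esub> y) = c (x \<oplus>\<^bsub>M\<^esub> y)" "c (y \<oplus>\<^bsub>M\<^esub> c x) = c (y \<oplus>\<^bsub>M\<^esub> x)"
    if x: "x \<in> carrier M" and y: "y \<in> carrier M" for x y
  proof -
    obtain n where n: "n \<in> N" "c x = x \<oplus>\<^bsub>M\<^esub> n" using c[OF x] by blast
    then have "c x \<oplus>\<^bsub>M\<^esub> y = (x \<oplus>\<^bsub>M\<^esub> y) \<oplus>\<^bsub>M\<^esub> n" "y \<oplus>\<^bsub>M\<^esub> c x = (y \<oplus>\<^bsub>M\<^esub> x) \<oplus>\<^bsub>M\<^esub> n"
      using x y N' by (simp_all add: M.M.a_ac)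
    then show "c (c x \<oplus>\<^bsub>M\<^esub> y) = c (x \<oplus>\<^bsub>M\<^esub> y)" "c (y \<oplus>\<^bsub>M\<^esub> c x) = c (y \<oplus>\<^bsub>M\<^esub> x)"
      using x y n by (simp_all add: c_shift)
  qed
  have c_idem: "c (c x) = c x" if "x \<in> carrier M" for x
    using c_add(1)[OF that M.M.zero_closed] c(1)[OF that] that by simp
  have c_smult: "c (a \<odot>\<^bsub>M\<^esub> c x) = c (a \<odot>\<^bsub>M\<^esub> x)" if a: "a \<in> carrier R" and x: "x \<in> carrier M" for a x
  proof -
    obtain n where n: "n \<in> N" "c x = x \<oplus>\<^bsub>M\<^esub> n" using c[OF x] by blast
    then have "a \<odot>\<^bsub>M\<^esub> c x = a \<odot>\<^bsub>M\<^esub> x \<oplus>\<^bsub>M\<^esub> a \<odot>\<^bsub>M\<^esub> n" using x a N' by (simp add: M.smult_r_distr)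
    then show ?thesis using a x n N' by (simp add: c_shift M.smult_closed)
  qed
  have c_add_smult: "c (a \<odot>\<^bsub>M\<^esub> c x \<oplus>\<^bsub>M\<^esub> b \<odot>\<^bsub>M\<^esub> c x) = c (a \<odot>\<^bsub>M\<^esub> x \<oplus>\<^bsub>M\<^esub> b \<odot>\<^bsub>M\<^esub> x)"
    if "a \<in> carrier R" "b \<in> carrier R" "x \<in> carrier M" for a b x
    using that c_smult[of "a \<oplus>\<^bsub>R\<^esub> b" x] c(1)[OF that(3)] by (simp add: M.smult_l_distr)
  define L :: "('a, 'm) module" where
    "L = \<lparr>carrier = c ` carrier M, monoid.mult = undefined, one = undefined,
          zero = c \<zero>\<^bsub>M\<^esub>, add = (\<lambda>u v. c (u \<oplus>\<^bsub>M\<^esub> v)), smult = (\<lambda>a u. c (a \<odot>\<^bsub>M\<^esub> u))\<rparr>"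
  have L [simp]: "carrier L = c ` carrier M" "\<zero>\<^bsub>L\<^esub> = c \<zero>\<^bsub>M\<^esub>"
    "\<And>u v. u \<oplus>\<^bsub>L\<^esub> v = c (u \<oplus>\<^bsub>M\<^esub> v)" "\<And>a u. a \<odot>\<^bsub>L\<^esub> u = c (a \<odot>\<^bsub>M\<^esub> u)"
    by (simp_all add: L_def)
  have "abelian_group L"
  proof (rule abelian_groupI)
    fix u assume "u \<in> carrier L"
    then obtain x where x: "u = c x" "x \<in> carrier M" by auto
    then show "\<exists>v \<in> carrier L. v \<oplus>\<^bsub>L\<^esub> u = \<zero>\<^bsub>L\<^esub>"
      by (intro bexI[of _ "c (\<ominus>\<^bsub>M\<^esub> x)"]) (auto simp: c c_add M.M.l_neg)
  next
    fix u v assume "u \<in> carrier L" "v \<in> carrier L"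
    then show "u \<oplus>\<^bsub>L\<^esub> v = v \<oplus>\<^bsub>L\<^esub> u" by (auto simp: c M.M.a_comm)
  qed (auto simp: c c_add c_idem M.M.a_assoc)
  then have rL: "right_module R L"
    by (intro right_module.intro right_module_axioms.intro M.R.ring_axioms)
      (auto simp: c c_add c_smult c_idem c_add_smult M.smult_closed M.smult_l_distr M.smult_r_distr M.smult_assoc
        M.smult_one)
  have hom: "c \<in> module_hom R M L" by (rule module_homI) (auto simp: c c_add c_smult)
  have ker: "a_kernel M L c = N"
  proof
    show "a_kernel M L c \<subseteq> N" using c_zero by (auto simp: kernel_iff)
    show "N \<subseteq> a_kernel M L c"
    proof
      fix n assume n: "n \<in> N"
      have "c n = c \<zero>\<^bsub>M\<^esub>" using c_shift[OF M.M.zero_closed n] N'(4)[OF n] by simp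
      then show "n \<in> a_kernel M L c" using N'(4)[OF n] by (simp add: kernel_iff)
    qed
  qed
  have surj: "c ` carrier M = carrier L" by simp
  show thesis by (rule that[OF fg_image[OF M rL hom surj] hom surj ker])
qed

definition biproduct where
  "biproduct R F G H i1 i2 q1 q2 \<longleftrightarrow> H \<in> fg_modules R \<and>
     i1 \<in> module_hom R F H \<and> i2 \<in> module_hom R G H \<and>
     q1 \<in> module_hom R H F \<and> q2 \<in> module_hom R H G \<and>
     (\<forall>x\<in>carrier F. q1 (i1 x) = x \<and> q2 (i1 x) = \<zero>\<^bsub>G\<^esub>) \<and>
     (\<forall>y\<in>carrier G. q2 (i2 y) = y \<and> q1 (i2 y) = \<zero>\<^bsub>F\<^esub>) \<and>
     (\<forall>z\<in>carrier H. i1 (q1 z) \<oplus>\<^bsub>H\<^esub> i2 (q2 z) = z)"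

lemma biproduct_exists:
  fixes F :: "('a, 'm) module" and G :: "('a, 'n) module"
  assumes F: "F \<in> fg_modules R" and G: "G \<in> fg_modules R"
  obtains H :: "('a, 'a list) module" and i1 i2 q1 q2 where "biproduct R F G H i1 i2 q1 q2"
proof -
  have rF: "right_module R F" and rG: "right_module R G"
    using F G by (auto intro: fg_modules_right_module)
  interpret F: right_module R F by (rule rF)
  interpret G: right_module R G by (rule rG)
  define D :: "('a, 'm \<times> 'n) module" where
    "D = \<lparr>carrier = carrier F \<times> carrier G, monoid.mult = undefined, one = undefined,
          zero = (\<zero>\<^bsub>F\<^esub>, \<zero>\<^bsub>G\<^esub>), add = (\<lambda>u v. (fst u \<oplus>\<^bsub>F\<^esub> fst v, snd u \<oplus>\<^bsub>G\<^esub> snd v)),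
          smult = (\<lambda>a u. (a \<odot>\<^bsub>F\<^esub> fst u, a \<odot>\<^bsub>G\<^esub> snd u))\<rparr>"
  have D [simp]: "carrier D = carrier F \<times> carrier G" "\<zero>\<^bsub>D\<^esub> = (\<zero>\<^bsub>F\<^esub>, \<zero>\<^bsub>G\<^esub>)"
    "\<And>u v. u \<oplus>\<^bsub>D\<^esub> v = (fst u \<oplus>\<^bsub>F\<^esub> fst v, snd u \<oplus>\<^bsub>G\<^esub> snd v)"
    "\<And>a u. a \<odot>\<^bsub>D\<^esub> u = (a \<odot>\<^bsub>F\<^esub> fst u, a \<odot>\<^bsub>G\<^esub> snd u)"
    by (simp_all add: D_def)
  have "abelian_group D"
  proof (rule abelian_groupI)
    fix u assume "u \<in> carrier D"
    then show "\<exists>v \<in> carrier D. v \<oplus>\<^bsub>D\<^esub> u = \<zero>\<^bsub>D\<^esub>"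
      by (intro bexI[of _ "(\<ominus>\<^bsub>F\<^esub> fst u, \<ominus>\<^bsub>G\<^esub> snd u)"]) (auto simp: F.M.l_neg G.M.l_neg)
  qed (auto simp: F.M.a_ac G.M.a_ac)
  then have rD: "right_module R D"
    by (intro right_module.intro right_module_axioms.intro F.R.ring_axioms)
      (auto simp: F.smult_closed F.smult_l_distr F.smult_r_distr F.smult_assoc F.smult_one
        G.smult_closed G.smult_l_distr G.smult_r_distr G.smult_assoc G.smult_one)
  have i1: "(\<lambda>x. (x, \<zero>\<^bsub>G\<^esub>)) \<in> module_hom R F D"
    by (rule module_homI) (auto simp: G.smult_zero)
  have i2: "(\<lambda>y. (\<zero>\<^bsub>F\<^esub>, y)) \<in> module_hom R G D"
    by (rule module_homI) (auto simp: F.smult_zero)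
  have q1: "fst \<in> module_hom R D F" by (rule module_homI) auto
  have q2: "snd \<in> module_hom R D G" by (rule module_homI) auto
  obtain B where B: "finite B" "B \<subseteq> carrier F" "generated_submodule R F B = carrier F"
    using F unfolding fg_modules_def finitely_generated_def by blast
  obtain C where C: "finite C" "C \<subseteq> carrier G" "generated_submodule R G C = carrier G"
    using G unfolding fg_modules_def finitely_generated_def by blast
  let ?E = "(\<lambda>x. (x, \<zero>\<^bsub>G\<^esub>)) ` B \<union> (\<lambda>y. (\<zero>\<^bsub>F\<^esub>, y)) ` C"
  have E: "finite ?E" "?E \<subseteq> carrier D" using B C by auto
  let ?W = "generated_submodule R D ?E"
  have W: "submodule ?W R D" using submodule_generated[OF rD E(2)] .
  have EW: "?E \<subseteq> ?W" by (rule generated_submodule_superset)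
  have "generated_submodule R F B \<subseteq> {x \<in> carrier F. (x, \<zero>\<^bsub>G\<^esub>) \<in> ?W}"
    using B EW by (intro generated_submodule_least submodule_vimage[OF rF rD i1 W]) auto
  moreover have "generated_submodule R G C \<subseteq> {y \<in> carrier G. (\<zero>\<^bsub>F\<^esub>, y) \<in> ?W}"
    using C EW by (intro generated_submodule_least submodule_vimage[OF rG rD i2 W]) auto
  ultimately have inW: "(x, \<zero>\<^bsub>G\<^esub>) \<in> ?W" "(\<zero>\<^bsub>F\<^esub>, y) \<in> ?W"
    if "x \<in> carrier F" "y \<in> carrier G" for x y
    using B(3) C(3) that by auto
  have "(x, y) \<in> ?W" if "x \<in> carrier F" "y \<in> carrier G" for x y
  proof -
    have "(x, \<zero>\<^bsub>G\<^esub>) \<oplus>\<^bsub>D\<^esub> (\<zero>\<^bsub>F\<^esub>, y) \<in> ?W"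
      using W inW[OF that] unfolding submodule_iff[OF rD] by blast
    then show ?thesis using that by simp
  qed
  then have "carrier D \<subseteq> ?W" by auto
  moreover have "?W \<subseteq> carrier D" using W unfolding submodule_iff[OF rD] by blast
  ultimately have "finitely_generated R D"
    using E unfolding finitely_generated_def by (intro exI[of _ ?E]) blast
  then have "D \<in> fg_modules R" using rD by (simp add: fg_modules_def)
  then obtain H :: "('a, 'a list) module" and f g where H: "H \<in> fg_modules R"
    "f \<in> module_hom R D H" "g \<in> module_hom R H D"
    "\<And>x. x \<in> carrier D \<Longrightarrow> g (f x) = x" "\<And>y. y \<in> carrier H \<Longrightarrow> f (g y) = y"
    using fg_list_copy by metis
  have "f (fst (g z), \<zero>\<^bsub>G\<^esub>) \<oplus>\<^bsub>H\<^esub> f (\<zero>\<^bsub>F\<^esub>, snd (g z)) = z" if z: "z \<in> carrier H" for z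
  proof -
    have gz: "g z \<in> carrier D" by (rule hom_closed[OF H(3) z])
    have "f (fst (g z), \<zero>\<^bsub>G\<^esub>) \<oplus>\<^bsub>H\<^esub> f (\<zero>\<^bsub>F\<^esub>, snd (g z))
        = f ((fst (g z), \<zero>\<^bsub>G\<^esub>) \<oplus>\<^bsub>D\<^esub> (\<zero>\<^bsub>F\<^esub>, snd (g z)))"
      using gz by (intro hom_add[OF H(2), symmetric]) auto
    also have "(fst (g z), \<zero>\<^bsub>G\<^esub>) \<oplus>\<^bsub>D\<^esub> (\<zero>\<^bsub>F\<^esub>, snd (g z)) = g z" using gz by (auto simp: prod_eq_iff)
    finally show ?thesis using H(5)[OF z] by simp
  qed
  then have "biproduct R F G H (\<lambda>x. f (x, \<zero>\<^bsub>G\<^esub>)) (\<lambda>y. f (\<zero>\<^bsub>F\<^esub>, y))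
      (\<lambda>z. fst (g z)) (\<lambda>z. snd (g z))"
    unfolding biproduct_def using H
    by (auto intro: hom_comp[OF i1] hom_comp[OF i2] hom_comp[OF _ q1] hom_comp[OF _ q2])
  then show thesis by (rule that)
qed

lemma biproduct_combine:
  assumes "biproduct R F G H i1 i2 q1 q2" "right_module R F" "right_module R G"
    "x \<in> carrier F" "y \<in> carrier G"
  shows "i1 x \<oplus>\<^bsub>H\<^esub> i2 y \<in> carrier H" "q1 (i1 x \<oplus>\<^bsub>H\<^esub> i2 y) = x" "q2 (i1 x \<oplus>\<^bsub>H\<^esub> i2 y) = y"
proof -
  interpret F: right_module R F by fact
  interpret G: right_module R G by fact
  interpret H: right_module R H
    using assms by (intro fg_modules_right_module) (simp add: biproduct_def)
  have i: "i1 \<in> module_hom R F H" "i2 \<in> module_hom R G H"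
    and q: "q1 \<in> module_hom R H F" "q2 \<in> module_hom R H G"
    using assms by (auto simp: biproduct_def)
  have c: "i1 x \<in> carrier H" "i2 y \<in> carrier H" using assms i by (auto intro: hom_closed)
  then show "i1 x \<oplus>\<^bsub>H\<^esub> i2 y \<in> carrier H" by simp
  show "q1 (i1 x \<oplus>\<^bsub>H\<^esub> i2 y) = x" "q2 (i1 x \<oplus>\<^bsub>H\<^esub> i2 y) = y"
    using assms by (simp_all add: hom_add[OF q(1) c] hom_add[OF q(2) c] biproduct_def)
qed

section \<open>Constructions of projective modules\<close>

lemma projective_retract:
  assumes P: "projective_module R P" and i: "i \<in> module_hom R K P" and r: "r \<in> module_hom R P K"
    and ri: "\<And>x. x \<in> carrier K \<Longrightarrow> r (i x) = x"
  shows "projective_module R K"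
  unfolding projective_module_def
proof (intro ballI impI)
  fix N L :: "('a, 'a list) module" and g f
  assume N: "N \<in> fg_modules R" and L: "L \<in> fg_modules R" and g: "g \<in> module_hom R N L"
    and f: "f \<in> module_hom R K L" and surj: "g ` carrier N = carrier L"
  obtain h where h: "h \<in> module_hom R P N" "\<And>x. x \<in> carrier P \<Longrightarrow> g (h x) = f (r x)"
    using projective_lift[OF P N L g surj hom_comp[OF r f]] by blast
  then show "\<exists>h\<in>module_hom R K N. \<forall>x\<in>carrier K. g (h x) = f x"
    using hom_comp[OF i h(1)] hom_closed[OF i] ri by (intro bexI[of _ "\<lambda>x. h (i x)"]) simp_all
qed

lemma projective_biproduct:
  assumes F: "projective_module R F" and G: "projective_module R G"
    and H: "biproduct R F G H i1 i2 q1 q2"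
  shows "projective_module R H"
  unfolding projective_module_def
proof (intro ballI impI)
  fix N L :: "('a, 'a list) module" and g f
  assume N: "N \<in> fg_modules R" and L: "L \<in> fg_modules R" and g: "g \<in> module_hom R N L"
    and f: "f \<in> module_hom R H L" and surj: "g ` carrier N = carrier L"
  have i: "i1 \<in> module_hom R F H" "i2 \<in> module_hom R G H"
    and q: "q1 \<in> module_hom R H F" "q2 \<in> module_hom R H G"
    and sum: "\<And>z. z \<in> carrier H \<Longrightarrow> i1 (q1 z) \<oplus>\<^bsub>H\<^esub> i2 (q2 z) = z"
    using H by (auto simp: biproduct_def)
  obtain h1 where h1: "h1 \<in> module_hom R F N" "\<And>x. x \<in> carrier F \<Longrightarrow> g (h1 x) = f (i1 x)"
    using projective_lift[OF F N L g surj hom_comp[OF i(1) f]] by blast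
  obtain h2 where h2: "h2 \<in> module_hom R G N" "\<And>x. x \<in> carrier G \<Longrightarrow> g (h2 x) = f (i2 x)"
    using projective_lift[OF G N L g surj hom_comp[OF i(2) f]] by blast
  show "\<exists>h\<in>module_hom R H N. \<forall>x\<in>carrier H. g (h x) = f x"
  proof (intro bexI ballI)
    show "(\<lambda>z. h1 (q1 z) \<oplus>\<^bsub>N\<^esub> h2 (q2 z)) \<in> module_hom R H N"
      by (intro hom_plus[OF fg_modules_right_module[OF N]] hom_comp[OF q(1) h1(1)] hom_comp[OF q(2) h2(1)])
    fix z assume z: "z \<in> carrier H"
    have "g (h1 (q1 z) \<oplus>\<^bsub>N\<^esub> h2 (q2 z)) = f (i1 (q1 z)) \<oplus>\<^bsub>L\<^esub> f (i2 (q2 z))"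
      using hom_closed[OF q(1) z] hom_closed[OF q(2) z] hom_closed[OF h1(1)] hom_closed[OF h2(1)]
      by (simp add: hom_add[OF g] h1 h2)
    also have "\<dots> = f (i1 (q1 z) \<oplus>\<^bsub>H\<^esub> i2 (q2 z))"
      using hom_closed[OF q(1) z] hom_closed[OF q(2) z] hom_closed[OF i(1)] hom_closed[OF i(2)]
      by (simp add: hom_add[OF f])
    finally show "g (h1 (q1 z) \<oplus>\<^bsub>N\<^esub> h2 (q2 z)) = f z" using sum[OF z] by simp
  qed
qed

lemma projective_zero:
  fixes R :: "('a, 'r) ring_scheme" and M :: "('a, 'm) module"
  assumes "right_module R M"
  shows "projective_module R (M\<lparr>carrier := {\<zero>\<^bsub>M\<^esub>}\<rparr>)"
  unfolding projective_module_def
proof (intro ballI impI)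
  fix N L :: "('a, 'a list) module" and g f
  assume N: "N \<in> fg_modules R" and L: "L \<in> fg_modules R" and g: "g \<in> module_hom R N L"
    and f: "f \<in> module_hom R (M\<lparr>carrier := {\<zero>\<^bsub>M\<^esub>}\<rparr>) L" and surj: "g ` carrier N = carrier L"
  have rN: "right_module R N" and rL: "right_module R L"
    using N L by (auto intro: fg_modules_right_module)
  interpret N: right_module R N by (rule rN)
  have rZ: "right_module R (M\<lparr>carrier := {\<zero>\<^bsub>M\<^esub>}\<rparr>)"
    by (intro right_module_submodule assms submodule_zero)
  have "f \<zero>\<^bsub>M\<^esub> = \<zero>\<^bsub>L\<^esub>" using hom_zero[OF rZ rL f] by simp
  then show "\<exists>h\<in>module_hom R (M\<lparr>carrier := {\<zero>\<^bsub>M\<^esub>}\<rparr>) N. \<forall>x\<in>carrier (M\<lparr>carrier := {\<zero>\<^bsub>M\<^esub>}\<rparr>). g (h x) = f x"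
    using hom_zero[OF rN rL g]
    by (intro bexI[of _ "\<lambda>_. \<zero>\<^bsub>N\<^esub>"] module_homI) (auto simp: N.smult_zero)
qed

text \<open>A short exact sequence with projective end terms splits.  With a section \<open>s\<close> of \<open>\<pi>\<close>, every
  \<open>y\<close> is the sum of \<open>y - s (\<pi> y)\<close> in the kernel and of \<open>s (\<pi> y)\<close>, and a lift is assembled from
  lifts on the two parts.\<close>

lemma projective_extension:
  fixes R :: "('a, 'r) ring_scheme" and Y :: "('a, 'm) module"
  assumes Y: "Y \<in> fg_modules R" and P: "P \<in> fg_modules R" "projective_module R P"
    and \<pi>: "\<pi> \<in> module_hom R Y P" "\<pi> ` carrier Y = carrier P"
    and K: "projective_module R (Y\<lparr>carrier := a_kernel Y P \<pi>\<rparr>)"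
  shows "projective_module R Y"
  unfolding projective_module_def
proof (intro ballI impI)
  fix N L :: "('a, 'a list) module" and g f
  assume N: "N \<in> fg_modules R" and L: "L \<in> fg_modules R" and g: "g \<in> module_hom R N L"
    and f: "f \<in> module_hom R Y L" and surj: "g ` carrier N = carrier L"
  have r: "right_module R Y" "right_module R P" "right_module R N" "right_module R L"
    using Y P N L by (auto intro: fg_modules_right_module)
  interpret Y: right_module R Y by (rule r)
  interpret P: right_module R P by (rule r)
  interpret L: right_module R L by (rule r)
  obtain s where s: "s \<in> module_hom R P Y" "\<And>x. x \<in> carrier P \<Longrightarrow> \<pi> (s x) = x"
    using projective_section[OF P(2,1) Y \<pi>] by blast
  let ?K = "Y\<lparr>carrier := a_kernel Y P \<pi>\<rparr>"
  let ?k = "\<lambda>y. y \<ominus>\<^bsub>Y\<^esub> s (\<pi> y)"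
  have s\<pi>: "s (\<pi> y) \<in> carrier Y" if "y \<in> carrier Y" for y
    using that by (intro hom_closed[OF s(1)] hom_closed[OF \<pi>(1)])
  have "?k \<in> module_hom R Y Y" by (intro hom_minus r hom_id hom_comp[OF \<pi>(1) s(1)])
  moreover have "?k y \<in> a_kernel Y P \<pi>" if y: "y \<in> carrier Y" for y
    using y s\<pi>[OF y] hom_closed[OF \<pi>(1) y]
    by (simp add: kernel_iff hom_diff[OF r(1,2) \<pi>(1)] s(2) P.M.diff_eq_zero_iff)
  ultimately have k: "?k \<in> module_hom R Y ?K" by (intro hom_corestrict) auto
  have "a_kernel Y P \<pi> \<subseteq> carrier Y" by (auto simp: kernel_iff)
  then have "f \<in> module_hom R ?K L" by (rule hom_restrict[OF f])
  then obtain h1 where h1: "h1 \<in> module_hom R ?K N" and "\<And>x. x \<in> carrier ?K \<Longrightarrow> g (h1 x) = f x"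
    using projective_lift[OF K N L g surj] by blast
  then have gh1: "g (h1 x) = f x" if "x \<in> a_kernel Y P \<pi>" for x using that by simp
  obtain h2 where h2: "h2 \<in> module_hom R P N" "\<And>x. x \<in> carrier P \<Longrightarrow> g (h2 x) = f (s x)"
    using projective_lift[OF P(2) N L g surj hom_comp[OF s(1) f]] by blast
  show "\<exists>h\<in>module_hom R Y N. \<forall>x\<in>carrier Y. g (h x) = f x"
  proof (intro bexI ballI)
    show "(\<lambda>y. h1 (?k y) \<oplus>\<^bsub>N\<^esub> h2 (\<pi> y)) \<in> module_hom R Y N"
      by (intro hom_plus[OF r(3)] hom_comp[OF k h1] hom_comp[OF \<pi>(1) h2(1)])
    fix y assume y: "y \<in> carrier Y"
    have kK: "?k y \<in> a_kernel Y P \<pi>" using hom_closed[OF k y] by simp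
    have "g (h1 (?k y) \<oplus>\<^bsub>N\<^esub> h2 (\<pi> y)) = g (h1 (?k y)) \<oplus>\<^bsub>L\<^esub> g (h2 (\<pi> y))"
      using hom_closed[OF k y] y
      by (intro hom_add[OF g] hom_closed[OF h1] hom_closed[OF h2(1)] hom_closed[OF \<pi>(1)])
    also have "\<dots> = f (?k y) \<oplus>\<^bsub>L\<^esub> f (s (\<pi> y))" using gh1[OF kK] h2(2)[OF hom_closed[OF \<pi>(1) y]] by simp
    also have "\<dots> = f y"
      using y s\<pi>[OF y] hom_closed[OF f] by (simp add: hom_diff[OF r(1,4) f] L.M.diff_add_cancel)
    finally show "g (h1 (?k y) \<oplus>\<^bsub>N\<^esub> h2 (\<pi> y)) = f y" .
  qed
qed

lemma projective_injective_image:
  assumes P: "projective_module R P" and r: "right_module R P" "right_module R M"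
    and f: "f \<in> module_hom R P M" "inj_on f (carrier P)"
  shows "projective_module R (M\<lparr>carrier := f ` carrier P\<rparr>)"
proof -
  let ?I = "M\<lparr>carrier := f ` carrier P\<rparr>"
  have rI: "right_module R ?I"
    by (intro right_module_submodule submodule_image[OF r f(1)] submodule_carrier r)
  have fI: "f \<in> module_hom R P ?I" by (rule hom_corestrict[OF f(1)]) simp
  have "bij_betw f (carrier P) (carrier ?I)" using f(2) by (simp add: bij_betw_def)
  note inv = hom_inv(1)[OF fI this r(1) rI]
  show ?thesis
    by (rule projective_retract[OF P inv fI]) (auto simp: f_inv_into_f)
qed

section \<open>Projective dimension at most one\<close>

text \<open>One projective module over \<open>M\<close> with projective kernel is asked for, rather than an infinite
  resolution; \<open>projective_dimension_le_one_iff\<close> links this to the projective dimension.\<close>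

definition pd_le_one :: "('a, 'r) ring_scheme \<Rightarrow> ('a, 'm) module \<Rightarrow> bool" where
  "pd_le_one R M \<longleftrightarrow> (\<exists>(P :: ('a, 'a list) module) p. P \<in> fg_modules R \<and> projective_module R P \<and>
     p \<in> module_hom R P M \<and> p ` carrier P = carrier M \<and>
     projective_module R (P\<lparr>carrier := a_kernel P M p\<rparr>))"

definition pd_le_two :: "('a, 'r) ring_scheme \<Rightarrow> ('a, 'm) module \<Rightarrow> bool" where
  "pd_le_two R M \<longleftrightarrow> (\<exists>(P :: ('a, 'a list) module) p. P \<in> fg_modules R \<and> projective_module R P \<and>
     p \<in> module_hom R P M \<and> p ` carrier P = carrier M \<and>
     pd_le_one R (P\<lparr>carrier := a_kernel P M p\<rparr>))"

lemma iso_kernel_image: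
  assumes r: "right_module R M" "right_module R N"
    and f: "f \<in> module_hom R N M" "bij_betw f (carrier N) (carrier M)"
    and p: "\<And>x. x \<in> carrier P \<Longrightarrow> p x \<in> carrier N" "p ` carrier P = carrier N"
  shows "(\<lambda>x. f (p x)) ` carrier P = carrier M" "a_kernel P M (\<lambda>x. f (p x)) = a_kernel P N p"
proof -
  have "(\<lambda>x. f (p x)) ` carrier P = f ` p ` carrier P" by auto
  then show "(\<lambda>x. f (p x)) ` carrier P = carrier M" using f(2) p(2) by (simp add: bij_betw_def)
  show "a_kernel P M (\<lambda>x. f (p x)) = a_kernel P N p"
    using f(2) hom_zero[OF r(2,1) f(1)] hom_inj_iff[OF r(2,1) f(1)] p(1)
    by (auto simp: kernel_iff bij_betw_def)
qed

lemma pd_le_one_iso: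
  assumes r: "right_module R M" "right_module R N"
    and f: "f \<in> module_hom R N M" "bij_betw f (carrier N) (carrier M)" and N: "pd_le_one R N"
  shows "pd_le_one R M"
proof -
  obtain P :: "('a, 'a list) module" and p where P: "P \<in> fg_modules R" "projective_module R P"
     "p \<in> module_hom R P N" "p ` carrier P = carrier N"
     "projective_module R (P\<lparr>carrier := a_kernel P N p\<rparr>)"
    using N unfolding pd_le_one_def by blast
  note fp = iso_kernel_image[OF r f hom_closed[OF P(3)] P(4)]
  show ?thesis unfolding pd_le_one_def using P hom_comp[OF P(3) f(1)] fp
    by (intro exI[of _ P] exI[of _ "\<lambda>x. f (p x)"]) simp
qed

lemma pd_le_one_projective:
  fixes P :: "('a, 'a list) module"
  assumes P: "P \<in> fg_modules R" "projective_module R P"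
  shows "pd_le_one R P"
proof -
  have rP: "right_module R P" using P by (intro fg_modules_right_module)
  interpret P: right_module R P by (rule rP)
  have "a_kernel P P (\<lambda>x. x) = {\<zero>\<^bsub>P\<^esub>}" by (auto simp: kernel_iff)
  then show ?thesis unfolding pd_le_one_def using P hom_id projective_zero[OF rP]
    by (intro exI[of _ P] exI[of _ "\<lambda>x. x"]) simp
qed

text \<open>The infimum in the definition of the projective dimension is attained, as extended natural
  numbers are well ordered.\<close>

lemma projective_dimension_le_iff:
  "projective_dimension R M \<le> enat m \<longleftrightarrow>
    (\<exists>n\<le>m. \<exists>p P d. projective_resolution R M p P d \<and> (\<forall>i>n. carrier (P i) = {\<zero>\<^bsub>P i\<^esub>}))"
  (is "_ \<longleftrightarrow> (\<exists>n\<le>m. ?Q n)")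
proof
  assume le: "projective_dimension R M \<le> enat m"
  let ?A = "{enat n | n. ?Q n}"
  have "?A \<noteq> {}" using le unfolding projective_dimension_def by (auto simp: Inf_enat_def split: if_splits)
  then obtain a where a: "a \<in> ?A" by blast
  then have "(LEAST x. x \<in> ?A) \<in> ?A" by (rule LeastI)
  then have "Inf ?A \<in> ?A" using a by (auto simp: Inf_enat_def)
  then obtain n where "Inf ?A = enat n" "?Q n" by blast
  then show "\<exists>n\<le>m. ?Q n" using le unfolding projective_dimension_def by auto
next
  assume "\<exists>n\<le>m. ?Q n"
  then obtain n where "n \<le> m" "?Q n" by blast
  then have "projective_dimension R M \<le> enat n" unfolding projective_dimension_def by (intro Inf_lower) blast
  then show "projective_dimension R M \<le> enat m" using \<open>n \<le> m\<close> by (meson enat_ord_simps(1) order_trans)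
qed

text \<open>All that the homological arguments need of a finite-dimensional algebra: submodules of finitely
  generated modules are finitely generated and have simple submodules.\<close>

locale finite_length_ring =
  fixes R :: "('a, 'r) ring_scheme"
  assumes ring: "ring R" and length: "bounded_length R (regular_module R)"
begin

lemma fg_modules_submodule:
  assumes "M \<in> fg_modules R" "submodule N R M"
  shows "M\<lparr>carrier := N\<rparr> \<in> fg_modules R"
proof -
  have rM: "right_module R M" "finitely_generated R M" using assms by (auto simp: fg_modules_def)
  have "bounded_length R M" by (rule bounded_length_fg[OF rM length])
  then show ?thesis
    using fg_submodule[OF rM(1) _ assms(2)] right_module_submodule[OF rM(1) assms(2)]
    by (simp add: fg_modules_def)
qed

lemma fg_modules_kernel:
  assumes "M \<in> fg_modules R" "N \<in> fg_modules R" "f \<in> module_hom R M N"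
  shows "M\<lparr>carrier := a_kernel M N f\<rparr> \<in> fg_modules R"
  using assms by (intro fg_modules_submodule submodule_kernel) (auto intro: fg_modules_right_module)

lemma projective_dimension_le_one_iff:
  assumes M: "M \<in> fg_modules R"
  shows "projective_dimension R M \<le> 1 \<longleftrightarrow> pd_le_one R M"
proof
  assume "projective_dimension R M \<le> 1"
  then obtain n p P d where "n \<le> 1" and res: "projective_resolution R M p P d"
    and "\<forall>i>n. carrier (P i) = {\<zero>\<^bsub>P i\<^esub>}"
    using projective_dimension_le_iff[of R M 1] by (auto simp: one_enat_def)
  then have P2: "carrier (P 2) = {\<zero>\<^bsub>P 2\<^esub>}" by simp
  have P: "\<And>i. P i \<in> fg_modules R" "\<And>i. projective_module R (P i)" "p \<in> module_hom R (P 0) M"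
    "\<And>i. d i \<in> module_hom R (P (Suc i)) (P i)" "p ` carrier (P 0) = carrier M"
    "d 0 ` carrier (P 1) = a_kernel (P 0) M p" "d 1 ` carrier (P 2) = a_kernel (P 1) (P 0) (d 0)"
    using res by (auto simp: projective_resolution_def numeral_2_eq_2)
  have rP: "right_module R (P i)" for i using P(1) by (rule fg_modules_right_module)
  have "d 1 \<zero>\<^bsub>P 2\<^esub> = \<zero>\<^bsub>P 1\<^esub>" using hom_zero[OF rP rP P(4)[of 1]] by (simp add: numeral_2_eq_2)
  then have "a_kernel (P 1) (P 0) (d 0) = {\<zero>\<^bsub>P 1\<^esub>}" using P(7) P2 by simp
  then have "inj_on (d 0) (carrier (P 1))"
    using hom_inj_iff[OF rP rP P(4)[of 0]] by (auto simp: kernel_iff set_eq_iff)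
  then have "projective_module R ((P 0)\<lparr>carrier := d 0 ` carrier (P 1)\<rparr>)"
    using projective_injective_image[OF P(2) rP rP P(4)[of 0]] by simp
  then show "pd_le_one R M"
    unfolding pd_le_one_def P(6) using P(1,2,3,5) by blast
next
  assume "pd_le_one R M"
  then obtain P :: "('a, 'a list) module" and p where P: "P \<in> fg_modules R" "projective_module R P"
     "p \<in> module_hom R P M" "p ` carrier P = carrier M"
     "projective_module R (P\<lparr>carrier := a_kernel P M p\<rparr>)"
    unfolding pd_le_one_def by blast
  have rP: "right_module R P" and rM: "right_module R M"
    using P M by (auto intro: fg_modules_right_module)
  interpret P: right_module R P by (rule rP)
  have p0: "p \<zero>\<^bsub>P\<^esub> = \<zero>\<^bsub>M\<^esub>" by (rule hom_zero[OF rP rM P(3)])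
  \<comment> \<open>The resolution is 0 --> ker p --> P; all its terms are submodules of P and all its maps inclusions.\<close>
  define C where "C i = (if i = 0 then carrier P else if i = 1 then a_kernel P M p else {\<zero>\<^bsub>P\<^esub>})" for i :: nat
  have C: "submodule (C i) R P" for i
    using submodule_carrier[OF rP] submodule_kernel[OF rP rM P(3)] submodule_zero[OF rP]
    by (simp add: C_def)
  have CS: "C (Suc i) \<subseteq> C i" for i by (auto simp: C_def kernel_iff p0)
  have proj: "projective_module R (P\<lparr>carrier := C i\<rparr>)" for i
    using P(2,5) projective_zero[OF rP] by (simp add: C_def)
  have "projective_resolution R M p (\<lambda>i. P\<lparr>carrier := C i\<rparr>) (\<lambda>i x. x)"
    unfolding projective_resolution_def
  proof (intro conjI allI)
    show "P\<lparr>carrier := C i\<rparr> \<in> fg_modules R" for i by (rule fg_modules_submodule[OF P(1) C])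
    show "projective_module R (P\<lparr>carrier := C i\<rparr>)" for i by (rule proj)
    show "p \<in> module_hom R (P\<lparr>carrier := C 0\<rparr>) M" using P(3) by (simp add: C_def)
    show "(\<lambda>x. x) \<in> module_hom R (P\<lparr>carrier := C (Suc i)\<rparr>) (P\<lparr>carrier := C i\<rparr>)" for i
      using CS[of i] by (intro module_homI) auto
    show "p ` carrier (P\<lparr>carrier := C 0\<rparr>) = carrier M" using P(4) by (simp add: C_def)
    show "(\<lambda>x. x) ` carrier (P\<lparr>carrier := C 1\<rparr>) = a_kernel (P\<lparr>carrier := C 0\<rparr>) M p"
      by (simp add: C_def)
    show "(\<lambda>x. x) ` carrier (P\<lparr>carrier := C (Suc (Suc i))\<rparr>) =
        a_kernel (P\<lparr>carrier := C (Suc i)\<rparr>) (P\<lparr>carrier := C i\<rparr>) (\<lambda>x. x)" for i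
      by (auto simp: kernel_iff C_def p0)
  qed
  moreover have "\<forall>i>1. carrier (P\<lparr>carrier := C i\<rparr>) = {\<zero>\<^bsub>P\<lparr>carrier := C i\<rparr>\<^esub>}" by (simp add: C_def)
  ultimately show "projective_dimension R M \<le> 1"
    unfolding projective_dimension_le_iff one_enat_def by blast
qed

lemma pd_le_two_if_projective_dimension_le_two:
  assumes M: "M \<in> fg_modules R" and pd: "projective_dimension R M \<le> 2"
  shows "pd_le_two R M"
proof -
  have pd': "projective_dimension R M \<le> enat 2" using pd by (metis numeral_eq_enat)
  then obtain n p P d where "n \<le> 2" and res: "projective_resolution R M p P d"
    and "\<forall>i>n. carrier (P i) = {\<zero>\<^bsub>P i\<^esub>}"
    using projective_dimension_le_iff[of R M 2] by auto
  then have P3: "carrier (P 3) = {\<zero>\<^bsub>P 3\<^esub>}" by simp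
  have P: "\<And>i. P i \<in> fg_modules R" "\<And>i. projective_module R (P i)" "p \<in> module_hom R (P 0) M"
    "\<And>i. d i \<in> module_hom R (P (Suc i)) (P i)" "p ` carrier (P 0) = carrier M"
    "d 0 ` carrier (P 1) = a_kernel (P 0) M p" "d 1 ` carrier (P 2) = a_kernel (P 1) (P 0) (d 0)"
    "d 2 ` carrier (P 3) = a_kernel (P 2) (P 1) (d 1)"
    using res by (auto simp: projective_resolution_def numeral_2_eq_2 numeral_3_eq_3)
  have rP: "right_module R (P i)" for i using P(1) by (rule fg_modules_right_module)
  have rM: "right_module R M" using M by (rule fg_modules_right_module)
  have d1: "d 1 \<in> module_hom R (P 2) (P 1)" using P(4)[of 1] by (simp add: numeral_2_eq_2)
  have "d 2 \<zero>\<^bsub>P 3\<^esub> = \<zero>\<^bsub>P 2\<^esub>" using hom_zero[OF rP rP P(4)[of 2]] by (simp add: numeral_3_eq_3)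
  then have "a_kernel (P 2) (P 1) (d 1) = {\<zero>\<^bsub>P 2\<^esub>}" using P(8) P3 by simp
  then have "inj_on (d 1) (carrier (P 2))"
    using hom_inj_iff[OF rP rP d1] by (auto simp: kernel_iff set_eq_iff)
  then have proj: "projective_module R ((P 1)\<lparr>carrier := a_kernel (P 1) (P 0) (d 0)\<rparr>)"
    using projective_injective_image[OF P(2) rP rP d1] P(7) by simp
  have "d 0 \<in> module_hom R (P 1) ((P 0)\<lparr>carrier := a_kernel (P 0) M p\<rparr>)"
    using P(4)[of 0] P(6) by (intro hom_corestrict) auto
  then have "pd_le_one R ((P 0)\<lparr>carrier := a_kernel (P 0) M p\<rparr>)"
    unfolding pd_le_one_def using P(1,2,6) proj by (intro exI[of _ "P 1"] exI[of _ "d 0"]) simp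
  then show ?thesis unfolding pd_le_two_def using P(1,2,3,5) by blast
qed

text \<open>A form of Schanuel's lemma: whether a second syzygy of \<open>L\<close> is projective does not depend on the
  choices.  Let \<open>a : P0 \<rightarrow> P\<close> and \<open>b : P \<rightarrow> P0\<close> be lifts of the identity of \<open>L\<close>, and let \<open>q\<close> map a
  projective module \<open>Q\<close> onto \<open>ker p0\<close> with projective kernel.  On \<open>H = Q \<oplus> P\<close> put
  \<open>u (y, x) = b x - q y\<close> and \<open>t (y, x) = x - a (u (y, x))\<close>.  Then \<open>t\<close> maps \<open>H\<close> onto \<open>ker p\<close>, and
  \<open>u\<close> maps \<open>ker t\<close> onto \<open>P0\<close> with a kernel isomorphic to that of \<open>q\<close>.  So \<open>ker t\<close> is an
  extension of projective modules.\<close>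

lemma schanuel_pd_le_one:
  fixes P0 P :: "('a, 'a list) module"
  assumes P0: "P0 \<in> fg_modules R" "projective_module R P0"
    and P: "P \<in> fg_modules R" "projective_module R P" and L: "L \<in> fg_modules R"
    and p0: "p0 \<in> module_hom R P0 L" "p0 ` carrier P0 = carrier L"
    and p: "p \<in> module_hom R P L" "p ` carrier P = carrier L"
    and K0: "pd_le_one R (P0\<lparr>carrier := a_kernel P0 L p0\<rparr>)"
  shows "pd_le_one R (P\<lparr>carrier := a_kernel P L p\<rparr>)"
proof -
  let ?K0 = "P0\<lparr>carrier := a_kernel P0 L p0\<rparr>" and ?X = "P\<lparr>carrier := a_kernel P L p\<rparr>"
  obtain Q :: "('a, 'a list) module" and q where Q: "Q \<in> fg_modules R" "projective_module R Q"
    and q: "q \<in> module_hom R Q ?K0" "q ` carrier Q = carrier ?K0"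
    and K1: "projective_module R (Q\<lparr>carrier := a_kernel Q ?K0 q\<rparr>)"
    using K0 unfolding pd_le_one_def by blast
  have r: "right_module R P0" "right_module R P" "right_module R L" "right_module R Q"
    using P0 P L Q by (auto intro: fg_modules_right_module)
  interpret P0: right_module R P0 by (rule r)
  interpret P: right_module R P by (rule r)
  interpret L: right_module R L by (rule r)
  interpret Q: right_module R Q by (rule r)
  have q0: "q \<in> module_hom R Q P0" by (rule hom_expand[OF q(1)]) (auto simp: kernel_iff)
  have p0q: "p0 (q y) = \<zero>\<^bsub>L\<^esub>" if "y \<in> carrier Q" for y
    using hom_closed[OF q(1) that] by (simp add: kernel_iff)
  obtain a where a: "a \<in> module_hom R P0 P" "\<And>x. x \<in> carrier P0 \<Longrightarrow> p (a x) = p0 x"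
    using projective_lift[OF P0(2) P(1) L p p0(1)] by blast
  obtain b where b: "b \<in> module_hom R P P0" "\<And>x. x \<in> carrier P \<Longrightarrow> p0 (b x) = p x"
    using projective_lift[OF P(2) P0(1) L p0 p(1)] by blast
  obtain H :: "('a, 'a list) module" and i1 i2 q1 q2 where H: "biproduct R Q P H i1 i2 q1 q2"
    using biproduct_exists[OF Q(1) P(1)] by blast
  have HH: "H \<in> fg_modules R" and q12: "q1 \<in> module_hom R H Q" "q2 \<in> module_hom R H P"
    and i1: "i1 \<in> module_hom R Q H" "\<And>x. x \<in> carrier Q \<Longrightarrow> q1 (i1 x) = x \<and> q2 (i1 x) = \<zero>\<^bsub>P\<^esub>"
    and i2: "i2 \<in> module_hom R P H"
    and sum: "\<And>z. z \<in> carrier H \<Longrightarrow> i1 (q1 z) \<oplus>\<^bsub>H\<^esub> i2 (q2 z) = z"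
    using H by (auto simp: biproduct_def)
  have rH: "right_module R H" using HH by (rule fg_modules_right_module)
  interpret H: right_module R H by (rule rH)
  have projH: "projective_module R H" by (rule projective_biproduct[OF Q(2) P(2) H])
  let ?u = "\<lambda>z. b (q2 z) \<ominus>\<^bsub>P0\<^esub> q (q1 z)"
  let ?t = "\<lambda>z. q2 z \<ominus>\<^bsub>P\<^esub> a (?u z)"
  have u: "?u \<in> module_hom R H P0"
    by (intro hom_minus[OF r(1)] hom_comp[OF q12(2) b(1)] hom_comp[OF q12(1) q0])
  have t: "?t \<in> module_hom R H P" by (intro hom_minus[OF r(2)] q12(2) hom_comp[OF u a(1)])
  have tX: "?t z \<in> a_kernel P L p" if z: "z \<in> carrier H" for z
  proof -
    note c = hom_closed[OF q12(1) z] hom_closed[OF q12(2) z] hom_closed[OF u z]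
    note cb = hom_closed[OF b(1) c(2)] hom_closed[OF q0 c(1)] hom_closed[OF p(1) c(2)]
    have "p0 (?u z) = p0 (b (q2 z)) \<ominus>\<^bsub>L\<^esub> p0 (q (q1 z))" by (rule hom_diff[OF r(1,3) p0(1) cb(1,2)])
    also have "\<dots> = p (q2 z)" using c cb b(2) p0q by (simp add: L.M.minus_eq)
    finally have "p (a (?u z)) = p (q2 z)" using a(2)[OF c(3)] by simp
    then have "p (?t z) = \<zero>\<^bsub>L\<^esub>"
      using hom_diff[OF r(2,3) p(1) c(2) hom_closed[OF a(1) c(3)]] cb(3)
      by (simp add: L.M.diff_eq_zero_iff)
    then show ?thesis using hom_closed[OF t z] by (simp add: kernel_iff)
  qed
  have t': "?t \<in> module_hom R H ?X" using t tX by (intro hom_corestrict) auto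
  have surj: "?t ` carrier H = carrier ?X"
  proof
    show "?t ` carrier H \<subseteq> carrier ?X" using tX by auto
    show "carrier ?X \<subseteq> ?t ` carrier H"
    proof
      fix x assume "x \<in> carrier ?X"
      then have x: "x \<in> carrier P" "p x = \<zero>\<^bsub>L\<^esub>" by (auto simp: kernel_iff)
      \<comment> \<open>the preimage (y, x) with q y = b x has u = 0\<close>
      have "b x \<in> carrier ?K0" using x hom_closed[OF b(1)] b(2) by (simp add: kernel_iff)
      then have "b x \<in> q ` carrier Q" by (simp only: q(2))
      then obtain y where y: "y \<in> carrier Q" "q y = b x" by auto
      note c = biproduct_combine[OF H r(4,2) y(1) x(1)]
      have bx: "b x \<in> carrier P0" by (rule hom_closed[OF b(1) x(1)])
      have "b x \<ominus>\<^bsub>P0\<^esub> b x = \<zero>\<^bsub>P0\<^esub>" using bx by (simp add: P0.M.diff_eq_zero_iff)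
      then have "?t (i1 y \<oplus>\<^bsub>H\<^esub> i2 x) = x"
        using c y x hom_zero[OF r(1,2) a(1)] by (simp add: P.M.minus_eq)
      then show "x \<in> ?t ` carrier H" using c(1) by (metis (no_types, lifting) imageI)
    qed
  qed
  let ?Y = "H\<lparr>carrier := a_kernel H P ?t\<rparr>"
  have Y: "?Y \<in> fg_modules R" by (rule fg_modules_kernel[OF HH P(1) t])
  have Ysub: "a_kernel H P ?t \<subseteq> carrier H" by (auto simp: kernel_iff)
  have uY: "?u \<in> module_hom R ?Y P0" by (rule hom_restrict[OF u Ysub])
  have usurj: "?u ` carrier ?Y = carrier P0"
  proof
    show "?u ` carrier ?Y \<subseteq> carrier P0" using hom_closed[OF uY] by auto
    show "carrier P0 \<subseteq> ?u ` carrier ?Y"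
    proof
      fix y assume y: "y \<in> carrier P0"
      have ay: "a y \<in> carrier P" "b (a y) \<in> carrier P0"
        using y hom_closed[OF a(1)] hom_closed[OF b(1)] by auto
      \<comment> \<open>the preimage (v, a y), where v corrects b (a y) to y\<close>
      have "p0 (b (a y) \<ominus>\<^bsub>P0\<^esub> y) = \<zero>\<^bsub>L\<^esub>"
        using hom_diff[OF r(1,3) p0(1) ay(2) y] b(2)[OF ay(1)] a(2)[OF y] hom_closed[OF p0(1) y]
        by (simp add: L.M.diff_eq_zero_iff)
      then have "b (a y) \<ominus>\<^bsub>P0\<^esub> y \<in> carrier ?K0" using ay y by (simp add: kernel_iff)
      then have "b (a y) \<ominus>\<^bsub>P0\<^esub> y \<in> q ` carrier Q" by (simp only: q(2))
      then obtain v where v: "v \<in> carrier Q" "q v = b (a y) \<ominus>\<^bsub>P0\<^esub> y" by auto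
      note c = biproduct_combine[OF H r(4,2) v(1) ay(1)]
      let ?z = "i1 v \<oplus>\<^bsub>H\<^esub> i2 (a y)"
      have "?u ?z = b (a y) \<ominus>\<^bsub>P0\<^esub> (b (a y) \<ominus>\<^bsub>P0\<^esub> y)" using c v by simp
      also have "\<dots> = y" using ay y
        by (simp add: P0.M.minus_eq P0.M.minus_add P0.M.a_assoc[symmetric] P0.M.r_neg)
      finally have uz: "?u ?z = y" .
      then have "?t ?z = \<zero>\<^bsub>P\<^esub>" using c ay by (simp add: P.M.diff_eq_zero_iff)
      then have "?z \<in> carrier ?Y" using c(1) by (simp add: kernel_iff)
      then show "y \<in> ?u ` carrier ?Y" using uz by (metis (no_types, lifting) imageI)
    qed
  qed
  let ?Q1 = "Q\<lparr>carrier := a_kernel Q ?K0 q\<rparr>"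
  let ?Z = "?Y\<lparr>carrier := a_kernel ?Y P0 ?u\<rparr>"
  have Z: "q2 z = \<zero>\<^bsub>P\<^esub> \<and> q (q1 z) = \<zero>\<^bsub>P0\<^esub> \<and> z \<in> carrier H" if "z \<in> carrier ?Z" for z
  proof -
    have z: "z \<in> carrier H" "?t z = \<zero>\<^bsub>P\<^esub>" "?u z = \<zero>\<^bsub>P0\<^esub>" using that by (auto simp: kernel_iff)
    note c = hom_closed[OF q12(1) z(1)] hom_closed[OF q12(2) z(1)]
    have "q2 z = \<zero>\<^bsub>P\<^esub>"
      using z(2) c(2) hom_zero[OF r(1,2) a(1)] unfolding z(3) by (simp add: P.M.diff_zero)
    moreover from this have "q (q1 z) = \<zero>\<^bsub>P0\<^esub>"
      using z(3) hom_zero[OF r(2,1) b(1)] hom_closed[OF q0 c(1)]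
      by (simp add: P0.M.diff_eq_zero_iff)
    ultimately show ?thesis using z(1) by simp
  qed
  \<comment> \<open>q1 and i1 identify the kernel of u on ker t with the kernel of q\<close>
  have q1Z: "q1 \<in> module_hom R ?Z ?Q1"
    using Z hom_closed[OF q12(1)]
    by (intro hom_corestrict[where N = Q] module_homI)
      (auto simp: kernel_iff hom_add[OF q12(1)] hom_smult[OF q12(1)])
  have i1Z: "i1 \<in> module_hom R ?Q1 ?Z"
  proof (rule module_homI)
    fix x assume "x \<in> carrier ?Q1"
    then have x: "x \<in> carrier Q" "q x = \<zero>\<^bsub>P0\<^esub>" by (auto simp: kernel_iff)
    have "?u (i1 x) = \<zero>\<^bsub>P0\<^esub>" using x i1(2) hom_zero[OF r(2,1) b(1)] by (simp add: P0.M.diff_zero)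
    moreover from this have "?t (i1 x) = \<zero>\<^bsub>P\<^esub>"
      using x i1(2) hom_zero[OF r(1,2) a(1)] by (simp add: P.M.diff_zero)
    ultimately show "i1 x \<in> carrier ?Z" using hom_closed[OF i1(1) x(1)] by (simp add: kernel_iff)
  qed (auto simp: kernel_iff hom_add[OF i1(1)] hom_smult[OF i1(1)])
  have "projective_module R ?Z"
  proof (rule projective_retract[OF K1 q1Z i1Z])
    fix z assume "z \<in> carrier ?Z"
    note z = Z[OF this]
    then show "i1 (q1 z) = z"
      using sum[of z] hom_zero[OF r(2) rH i2] hom_closed[OF i1(1) hom_closed[OF q12(1)]] by simp
  qed
  then have "projective_module R ?Y" by (rule projective_extension[OF Y P0 uY usurj])
  then show ?thesis
    unfolding pd_le_one_def using HH projH t' surj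
    by (intro exI[of _ H] exI[of _ ?t]) simp
qed

text \<open>Let \<open>p : P \<rightarrow> M\<close> be onto with \<open>P\<close> and \<open>ker p\<close> projective.  The preimage \<open>X\<close> of \<open>N\<close> is
  a syzygy of \<open>M/N\<close>, so \<open>pd X \<le> 1\<close> by Schanuel's lemma: there is a surjection \<open>s : P' \<rightarrow> X\<close> with
  \<open>P'\<close> and \<open>ker s\<close> projective.  Now \<open>P' \<rightarrow> X \<rightarrow> N\<close> is onto, and its kernel is an extension of \<open>ker p\<close> by
  \<open>ker s\<close>, hence projective.\<close>

lemma submodule_pd_le_one:
  assumes gl: "\<And>L :: ('a, 'a list) module. L \<in> fg_modules R \<Longrightarrow> pd_le_two R L"
    and M: "M \<in> fg_modules R" "pd_le_one R M" and N: "submodule N R M"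
  shows "pd_le_one R (M\<lparr>carrier := N\<rparr>)"
proof -
  obtain L1 :: "('a, 'b) module" and \<pi>1 where L1: "L1 \<in> fg_modules R" and \<pi>1: "\<pi>1 \<in> module_hom R M L1"
    "\<pi>1 ` carrier M = carrier L1" "a_kernel M L1 \<pi>1 = N"
    using exists_quotient[OF M(1) N] by blast
  obtain L :: "('a, 'a list) module" and l l' where L: "L \<in> fg_modules R"
    "l \<in> module_hom R L1 L" "l' \<in> module_hom R L L1"
    "\<And>x. x \<in> carrier L1 \<Longrightarrow> l' (l x) = x" "\<And>y. y \<in> carrier L \<Longrightarrow> l (l' y) = y"
    using fg_list_copy[OF L1] by metis
  have r: "right_module R M" "right_module R L1" "right_module R L"
    using M L1 L by (auto intro: fg_modules_right_module)
  have bij: "bij_betw l (carrier L1) (carrier L)"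
    using hom_closed[OF L(2)] hom_closed[OF L(3)] L(4,5) by (intro bij_betw_byWitness[of _ l']) auto
  let ?\<pi> = "\<lambda>x. l (\<pi>1 x)"
  have \<pi>: "?\<pi> \<in> module_hom R M L" by (rule hom_comp[OF \<pi>1(1) L(2)])
  have \<pi>s: "?\<pi> ` carrier M = carrier L" "a_kernel M L ?\<pi> = N"
    using iso_kernel_image[OF r(3,2) L(2) bij hom_closed[OF \<pi>1(1)] \<pi>1(2)] \<pi>1(3) by auto
  obtain P0 :: "('a, 'a list) module" and p0 where P0: "P0 \<in> fg_modules R" "projective_module R P0"
    and p0: "p0 \<in> module_hom R P0 L" "p0 ` carrier P0 = carrier L"
    and K0: "pd_le_one R (P0\<lparr>carrier := a_kernel P0 L p0\<rparr>)"
    using gl[OF L(1)] unfolding pd_le_two_def by blast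
  obtain P :: "('a, 'a list) module" and p where P: "P \<in> fg_modules R" "projective_module R P"
    and p: "p \<in> module_hom R P M" "p ` carrier P = carrier M"
    and K: "projective_module R (P\<lparr>carrier := a_kernel P M p\<rparr>)"
    using M(2) unfolding pd_le_one_def by blast
  have rP: "right_module R P" using P(1) by (rule fg_modules_right_module)
  have \<pi>p: "(\<lambda>x. ?\<pi> (p x)) \<in> module_hom R P L" by (rule hom_comp[OF p(1) \<pi>])
  have "(\<lambda>x. ?\<pi> (p x)) ` carrier P = ?\<pi> ` p ` carrier P" by (simp only: image_image)
  then have \<pi>ps: "(\<lambda>x. ?\<pi> (p x)) ` carrier P = carrier L" using p(2) \<pi>s(1) by simp
  let ?X = "P\<lparr>carrier := a_kernel P L (\<lambda>x. ?\<pi> (p x))\<rparr>"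
  have X: "x \<in> carrier ?X \<longleftrightarrow> x \<in> carrier P \<and> p x \<in> N" for x
    using hom_closed[OF p(1), of x] by (auto simp: kernel_iff \<pi>s(2)[symmetric])
  have Xsub: "carrier ?X \<subseteq> carrier P" by (auto simp: kernel_iff)
  obtain P' :: "('a, 'a list) module" and s where P': "P' \<in> fg_modules R" "projective_module R P'"
    and s: "s \<in> module_hom R P' ?X" "s ` carrier P' = carrier ?X"
    and K': "projective_module R (P'\<lparr>carrier := a_kernel P' ?X s\<rparr>)"
    using schanuel_pd_le_one[OF P0 P L(1) p0 \<pi>p \<pi>ps K0] unfolding pd_le_one_def by blast
  have s': "s \<in> module_hom R P' P" using hom_expand[OF s(1)] Xsub by simp
  let ?N = "M\<lparr>carrier := N\<rparr>"
  have sX: "s x \<in> carrier P" "p (s x) \<in> N" if "x \<in> carrier P'" for x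
    using hom_closed[OF s(1) that] unfolding X by auto
  have ps: "(\<lambda>x. p (s x)) \<in> module_hom R P' ?N"
    using sX by (intro hom_corestrict[OF hom_comp[OF s' p(1)]]) auto
  have NM: "N \<subseteq> carrier M" using N by (simp add: submodule_iff[OF r(1)])
  have pss: "(\<lambda>x. p (s x)) ` carrier P' = carrier ?N"
  proof
    show "(\<lambda>x. p (s x)) ` carrier P' \<subseteq> carrier ?N" using sX by auto
    show "carrier ?N \<subseteq> (\<lambda>x. p (s x)) ` carrier P'"
    proof
      fix n assume "n \<in> carrier ?N"
      then have n: "n \<in> N" by simp
      then have "n \<in> p ` carrier P" using NM p(2) by auto
      then obtain y where y: "y \<in> carrier P" "p y = n" by auto
      then have "y \<in> carrier ?X" using n unfolding X by simp
      then have "y \<in> s ` carrier P'" by (simp only: s(2))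
      then show "n \<in> (\<lambda>x. p (s x)) ` carrier P'" using y(2) by auto
    qed
  qed
  let ?Y = "P'\<lparr>carrier := a_kernel P' M (\<lambda>x. p (s x))\<rparr>" and ?K = "P\<lparr>carrier := a_kernel P M p\<rparr>"
  have Y: "?Y \<in> fg_modules R" by (rule fg_modules_kernel[OF P'(1) M(1) hom_comp[OF s' p(1)]])
  have Kfg: "?K \<in> fg_modules R" by (rule fg_modules_kernel[OF P(1) M(1) p(1)])
  have sY: "s \<in> module_hom R ?Y ?K"
    using sX by (intro hom_corestrict hom_restrict[OF s']) (auto simp: kernel_iff)
  have sYs: "s ` carrier ?Y = carrier ?K"
  proof
    show "s ` carrier ?Y \<subseteq> carrier ?K" using hom_closed[OF sY] by auto
    show "carrier ?K \<subseteq> s ` carrier ?Y"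
    proof
      fix x assume x: "x \<in> carrier ?K"
      then have "x \<in> carrier ?X"
        using N unfolding X by (auto simp: kernel_iff submodule_iff[OF r(1)])
      then have "x \<in> s ` carrier P'" by (simp only: s(2))
      then show "x \<in> s ` carrier ?Y" using x by (auto simp: kernel_iff)
    qed
  qed
  have "a_kernel ?Y ?K s = a_kernel P' ?X s"
    using hom_zero[OF rP r(1) p(1)] by (auto simp: kernel_iff)
  then have "projective_module R (?Y\<lparr>carrier := a_kernel ?Y ?K s\<rparr>)" using K' by simp
  then have "projective_module R ?Y" by (rule projective_extension[OF Y Kfg K sY sYs])
  then show ?thesis
    unfolding pd_le_one_def using P' ps pss
    by (intro exI[of _ P'] exI[of _ "\<lambda>x. p (s x)"]) simp
qed

end

section \<open>Vanishing of Hom and of the first Ext group\<close>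

lemma fg_regular:
  assumes R: "ring R"
  shows "regular_module R \<in> fg_modules R"
proof -
  interpret R: ring R by (rule R)
  have M: "right_module R (regular_module R)" by (rule right_module_regular[OF R])
  let ?G = "generated_submodule R (regular_module R) {\<one>\<^bsub>R\<^esub>}"
  have G: "submodule ?G R (regular_module R)"
    by (rule submodule_generated[OF M]) (simp add: regular_module_def)
  moreover have "\<one>\<^bsub>R\<^esub> \<in> ?G" using generated_submodule_superset[of "{\<one>\<^bsub>R\<^esub>}"] by blast
  ultimately have "a \<in> ?G" if "a \<in> carrier R" for a
    using that R.l_one[OF that] unfolding submodule_regular_iff[OF R] by metis
  then have "?G = carrier (regular_module R)"
    using G unfolding submodule_regular_iff[OF R] by (auto simp: regular_module_def)
  then have "finitely_generated R (regular_module R)"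
    unfolding finitely_generated_def by (intro exI[of _ "{\<one>\<^bsub>R\<^esub>}"]) (simp add: regular_module_def)
  then show ?thesis using M by (simp add: fg_modules_def)
qed

text \<open>Every finitely generated module is an image of a finite free module, in the form of an induction
  principle: a property of the regular module that is inherited by biproducts holds for some \<open>F\<close>
  mapping onto \<open>M\<close>.  Copies of the regular module enter through the retractions in \<open>base\<close>.\<close>

lemma free_cover_induct:
  fixes C :: "('a, 'a list) module \<Rightarrow> bool" and M :: "('a, 'm) module"
  assumes M: "M \<in> fg_modules R"
    and base: "\<And>(F :: ('a, 'a list) module) i r. \<lbrakk>F \<in> fg_modules R;
      i \<in> module_hom R (regular_module R) F; r \<in> module_hom R F (regular_module R);
      \<And>x. x \<in> carrier F \<Longrightarrow> i (r x) = x\<rbrakk> \<Longrightarrow> C F"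
    and step: "\<And>(F :: ('a, 'a list) module) (G :: ('a, 'a list) module) (H :: ('a, 'a list) module) i1 i2 q1 q2.
      \<lbrakk>F \<in> fg_modules R; G \<in> fg_modules R; C F; C G; biproduct R F G H i1 i2 q1 q2\<rbrakk> \<Longrightarrow> C H"
  obtains F f where "F \<in> fg_modules R" "C F" "f \<in> module_hom R F M" "f ` carrier F = carrier M"
proof -
  have rM: "right_module R M" using M by (rule fg_modules_right_module)
  interpret M: right_module R M by (rule rM)
  let ?R = "regular_module R"
  have ringR: "ring R" by (rule M.R.ring_axioms)
  obtain L :: "('a, 'a list) module" and l l' where L: "L \<in> fg_modules R"
    "l \<in> module_hom R ?R L" "l' \<in> module_hom R L ?R"
    "\<And>x. x \<in> carrier ?R \<Longrightarrow> l' (l x) = x" "\<And>y. y \<in> carrier L \<Longrightarrow> l (l' y) = y"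
    using fg_list_copy[OF fg_regular[OF ringR]] by metis
  have CL: "C L" by (rule base[OF L(1-3,5)])
  have cyc: "(\<lambda>z. l' z \<odot>\<^bsub>M\<^esub> x) \<in> module_hom R L M" if x: "x \<in> carrier M" for x
  proof -
    have "(\<lambda>a. a \<odot>\<^bsub>M\<^esub> x) \<in> module_hom R ?R M"
      using x by (intro module_homI)
        (auto simp: regular_module_def M.smult_closed M.smult_l_distr M.smult_assoc)
    then show ?thesis by (rule hom_comp[OF L(3)])
  qed
  have *: "\<exists>(F :: ('a, 'a list) module) f. F \<in> fg_modules R \<and> C F \<and> f \<in> module_hom R F M \<and> B \<subseteq> f ` carrier F"
    if "finite B" "B \<subseteq> carrier M" for B
    using that
  proof (induction B)
    case empty
    show ?case using L(1) CL cyc[OF M.M.zero_closed] by blast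
  next
    case (insert x B)
    then obtain F :: "('a, 'a list) module" and f
      where F: "F \<in> fg_modules R" "C F" "f \<in> module_hom R F M" "B \<subseteq> f ` carrier F" by auto
    have x: "x \<in> carrier M" using insert by auto
    let ?g = "\<lambda>z. l' z \<odot>\<^bsub>M\<^esub> x"
    have rF: "right_module R F" and rL: "right_module R L"
      using F L by (auto intro: fg_modules_right_module)
    interpret F: right_module R F by (rule rF)
    interpret L: right_module R L by (rule rL)
    obtain H :: "('a, 'a list) module" and i1 i2 q1 q2 where H: "biproduct R F L H i1 i2 q1 q2"
      using biproduct_exists[OF F(1) L(1)] by blast
    have q: "q1 \<in> module_hom R H F" "q2 \<in> module_hom R H L" and HH: "H \<in> fg_modules R"
      using H by (auto simp: biproduct_def)
    let ?h = "\<lambda>z. f (q1 z) \<oplus>\<^bsub>M\<^esub> ?g (q2 z)"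
    have h: "?h \<in> module_hom R H M"
      by (intro hom_plus[OF rM] hom_comp[OF q(1) F(3)] hom_comp[OF q(2) cyc[OF x]])
    have "y \<in> ?h ` carrier H" if "y \<in> B" for y
    proof -
      have "y \<in> f ` carrier F" by (rule subsetD[OF F(4) that])
      then obtain u where u: "u \<in> carrier F" "y = f u" by (rule imageE) simp
      note c = biproduct_combine[OF H rF rL u(1) L.M.zero_closed]
      have "?h (i1 u \<oplus>\<^bsub>H\<^esub> i2 \<zero>\<^bsub>L\<^esub>) = y"
        using c hom_zero[OF rL rM cyc[OF x]] hom_closed[OF F(3) u(1)] u(2) by simp
      then show ?thesis using c(1) by force
    qed
    moreover have "x \<in> ?h ` carrier H"
    proof -
      have one: "\<one>\<^bsub>R\<^esub> \<in> carrier ?R" by (simp add: regular_module_def)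
      note c = biproduct_combine[OF H rF rL F.M.zero_closed hom_closed[OF L(2) one]]
      have "?h (i1 \<zero>\<^bsub>F\<^esub> \<oplus>\<^bsub>H\<^esub> i2 (l \<one>\<^bsub>R\<^esub>)) = x"
        using c hom_zero[OF rF rM F(3)] L(4)[OF one] x by (simp add: M.smult_one)
      then show ?thesis using c(1) by force
    qed
    ultimately show ?case using HH step[OF F(1) L(1) F(2) CL H] h by blast
  qed
  obtain B where B: "finite B" "B \<subseteq> carrier M" "generated_submodule R M B = carrier M"
    using M unfolding fg_modules_def finitely_generated_def by blast
  obtain F :: "('a, 'a list) module" and f
    where F: "F \<in> fg_modules R" "C F" "f \<in> module_hom R F M" "B \<subseteq> f ` carrier F"
    using *[OF B(1,2)] by blast
  have rF: "right_module R F" using F by (intro fg_modules_right_module)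
  have "generated_submodule R M B \<subseteq> f ` carrier F"
    by (intro generated_submodule_least F submodule_image[OF rF rM] submodule_carrier rF)
  then have "f ` carrier F = carrier M" using B(3) hom_closed[OF F(3)] by auto
  then show thesis using F by (intro that)
qed

text \<open>For an exact sequence \<open>0 \<rightarrow> K \<rightarrow> P \<rightarrow> N \<rightarrow> 0\<close> with \<open>P\<close> projective this says
  \<open>Hom(N, F) = 0\<close> and \<open>Ext\<^sup>1(N, F) = 0\<close>, since \<open>Ext\<^sup>1(N, F)\<close> is the cokernel of the restriction
  \<open>Hom(P, F) \<rightarrow> Hom(K, F)\<close>.\<close>

definition hom_ext_vanish where
  "hom_ext_vanish R N P K F \<longleftrightarrow>
     (\<forall>\<phi>\<in>module_hom R N F. \<forall>x\<in>carrier N. \<phi> x = \<zero>\<^bsub>F\<^esub>) \<and>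
     (\<forall>\<phi>\<in>module_hom R K F. \<exists>\<psi>\<in>module_hom R P F. \<forall>x\<in>carrier K. \<psi> x = \<phi> x)"

lemma hom_ext_vanish_zero:
  "\<lbrakk>hom_ext_vanish R N P K F; \<phi> \<in> module_hom R N F; x \<in> carrier N\<rbrakk> \<Longrightarrow> \<phi> x = \<zero>\<^bsub>F\<^esub>"
  unfolding hom_ext_vanish_def by blast

lemma hom_ext_vanish_extend:
  assumes "hom_ext_vanish R N P K F" "\<phi> \<in> module_hom R K F"
  obtains \<psi> where "\<psi> \<in> module_hom R P F" "\<And>x. x \<in> carrier K \<Longrightarrow> \<psi> x = \<phi> x"
  using assms unfolding hom_ext_vanish_def by blast

lemma hom_ext_vanish_retract:
  assumes F: "hom_ext_vanish R N P K F" and r: "right_module R F" "right_module R G"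
    and i: "i \<in> module_hom R F G" and s: "s \<in> module_hom R G F"
    and retr: "\<And>x. x \<in> carrier G \<Longrightarrow> i (s x) = x"
  shows "hom_ext_vanish R N P K G"
  unfolding hom_ext_vanish_def
proof (intro conjI ballI)
  fix \<phi> x assume \<phi>: "\<phi> \<in> module_hom R N G" and x: "x \<in> carrier N"
  have "s (\<phi> x) = \<zero>\<^bsub>F\<^esub>" by (rule hom_ext_vanish_zero[OF F hom_comp[OF \<phi> s] x])
  then show "\<phi> x = \<zero>\<^bsub>G\<^esub>" using retr[OF hom_closed[OF \<phi> x]] hom_zero[OF r i] by simp
next
  fix \<phi> assume \<phi>: "\<phi> \<in> module_hom R K G"
  obtain \<psi> where \<psi>: "\<psi> \<in> module_hom R P F" "\<And>x. x \<in> carrier K \<Longrightarrow> \<psi> x = s (\<phi> x)"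
    using hom_ext_vanish_extend[OF F hom_comp[OF \<phi> s]] by blast
  then show "\<exists>\<psi>\<in>module_hom R P G. \<forall>x\<in>carrier K. \<psi> x = \<phi> x"
    using hom_comp[OF \<psi>(1) i] retr hom_closed[OF \<phi>] by (intro bexI[of _ "\<lambda>x. i (\<psi> x)"]) simp_all
qed

lemma hom_ext_vanish_biproduct:
  assumes F: "hom_ext_vanish R N P K F" and G: "hom_ext_vanish R N P K G"
    and r: "right_module R F" "right_module R G" and H: "biproduct R F G H i1 i2 q1 q2"
  shows "hom_ext_vanish R N P K H"
proof -
  have i: "i1 \<in> module_hom R F H" "i2 \<in> module_hom R G H" and HH: "H \<in> fg_modules R"
    and q: "q1 \<in> module_hom R H F" "q2 \<in> module_hom R H G"
    and sum: "\<And>z. z \<in> carrier H \<Longrightarrow> i1 (q1 z) \<oplus>\<^bsub>H\<^esub> i2 (q2 z) = z"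
    using H by (auto simp: biproduct_def)
  have rH: "right_module R H" using HH by (rule fg_modules_right_module)
  interpret H: right_module R H by (rule rH)
  show ?thesis unfolding hom_ext_vanish_def
  proof (intro conjI ballI)
    fix \<phi> x assume \<phi>: "\<phi> \<in> module_hom R N H" and x: "x \<in> carrier N"
    have "q1 (\<phi> x) = \<zero>\<^bsub>F\<^esub>" "q2 (\<phi> x) = \<zero>\<^bsub>G\<^esub>"
      by (rule hom_ext_vanish_zero[OF F hom_comp[OF \<phi> q(1)] x],
          rule hom_ext_vanish_zero[OF G hom_comp[OF \<phi> q(2)] x])
    then show "\<phi> x = \<zero>\<^bsub>H\<^esub>"
      using sum[OF hom_closed[OF \<phi> x]] hom_zero[OF r(1) rH i(1)] hom_zero[OF r(2) rH i(2)] by simp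
  next
    fix \<phi> assume \<phi>: "\<phi> \<in> module_hom R K H"
    obtain \<psi>1 where \<psi>1: "\<psi>1 \<in> module_hom R P F" "\<And>x. x \<in> carrier K \<Longrightarrow> \<psi>1 x = q1 (\<phi> x)"
      using hom_ext_vanish_extend[OF F hom_comp[OF \<phi> q(1)]] by blast
    obtain \<psi>2 where \<psi>2: "\<psi>2 \<in> module_hom R P G" "\<And>x. x \<in> carrier K \<Longrightarrow> \<psi>2 x = q2 (\<phi> x)"
      using hom_ext_vanish_extend[OF G hom_comp[OF \<phi> q(2)]] by blast
    show "\<exists>\<psi>\<in>module_hom R P H. \<forall>x\<in>carrier K. \<psi> x = \<phi> x"
      using hom_plus[OF rH hom_comp[OF \<psi>1(1) i(1)] hom_comp[OF \<psi>2(1) i(2)]] \<psi>1(2) \<psi>2(2)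
        sum hom_closed[OF \<phi>]
      by (intro bexI[of _ "\<lambda>x. i1 (\<psi>1 x) \<oplus>\<^bsub>H\<^esub> i2 (\<psi>2 x)"]) simp_all
  qed
qed

context finite_length_ring
begin

lemma hom_ext_vanish_cover:
  assumes R: "hom_ext_vanish R N P K (regular_module R)" and M: "M \<in> fg_modules R"
  obtains F :: "('a, 'a list) module" and f where "F \<in> fg_modules R" "hom_ext_vanish R N P K F"
    "f \<in> module_hom R F M" "f ` carrier F = carrier M"
proof (rule free_cover_induct[OF M, where C = "hom_ext_vanish R N P K"])
  fix F :: "('a, 'a list) module" and i r
  assume "F \<in> fg_modules R" "i \<in> module_hom R (regular_module R) F"
    "r \<in> module_hom R F (regular_module R)" "\<And>x. x \<in> carrier F \<Longrightarrow> i (r x) = x"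
  then show "hom_ext_vanish R N P K F"
    by (intro hom_ext_vanish_retract[OF R right_module_regular[OF ring]] fg_modules_right_module)
next
  fix F G H :: "('a, 'a list) module" and i1 i2 q1 q2
  assume "F \<in> fg_modules R" "G \<in> fg_modules R" "hom_ext_vanish R N P K F"
    "hom_ext_vanish R N P K G" "biproduct R F G H i1 i2 q1 q2"
  then show "hom_ext_vanish R N P K H"
    by (intro hom_ext_vanish_biproduct[of R N P K F G H i1 i2 q1 q2] fg_modules_right_module)
qed (rule that)

text \<open>Vanishing against \<open>R\<close> passes to finite free modules.  Let \<open>F\<close> be free and map onto the projective
  module \<open>K = ker p\<close>.  A section \<open>K \<rightarrow> F\<close> extends to \<open>P\<close>, which gives a retraction of \<open>P\<close> onto
  \<open>K\<close>.  One minus this retraction factors through \<open>N\<close> as a map \<open>h : N \<rightarrow> P\<close>.  As \<open>P\<close> embeds in a free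
  module \<open>F'\<close> and \<open>Hom(N, F') = 0\<close>, the map \<open>h\<close> is zero; so \<open>P = K\<close> and \<open>N = 0\<close>.\<close>

lemma trivial_if_hom_ext_vanish:
  fixes P :: "('a, 'a list) module"
  assumes N: "N \<in> fg_modules R" and P: "P \<in> fg_modules R" "projective_module R P"
    and p: "p \<in> module_hom R P N" "p ` carrier P = carrier N"
    and K: "projective_module R (P\<lparr>carrier := a_kernel P N p\<rparr>)"
    and R: "hom_ext_vanish R N P (P\<lparr>carrier := a_kernel P N p\<rparr>) (regular_module R)"
  shows "carrier N = {\<zero>\<^bsub>N\<^esub>}"
proof -
  let ?K = "P\<lparr>carrier := a_kernel P N p\<rparr>"
  have Kfg: "?K \<in> fg_modules R" by (rule fg_modules_kernel[OF P(1) N p(1)])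
  have r: "right_module R P" "right_module R N" using P N by (auto intro: fg_modules_right_module)
  interpret P: right_module R P by (rule r)
  interpret N: right_module R N by (rule r)
  obtain F :: "('a, 'a list) module" and f where F: "F \<in> fg_modules R" "hom_ext_vanish R N P ?K F"
    "f \<in> module_hom R F ?K" "f ` carrier F = carrier ?K"
    using hom_ext_vanish_cover[OF R Kfg] by blast
  obtain s where s: "s \<in> module_hom R ?K F" "\<And>x. x \<in> carrier ?K \<Longrightarrow> f (s x) = x"
    using projective_section[OF K Kfg F(1,3,4)] by blast
  obtain s' where s': "s' \<in> module_hom R P F" "\<And>x. x \<in> carrier ?K \<Longrightarrow> s' x = s x"
    using hom_ext_vanish_extend[OF F(2) s(1)] by blast
  have fP: "f \<in> module_hom R F P" by (rule hom_expand[OF F(3)]) (auto simp: kernel_iff)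
  let ?e = "\<lambda>x. x \<ominus>\<^bsub>P\<^esub> f (s' x)"
  have e: "?e \<in> module_hom R P P" by (intro hom_minus[OF r(1)] hom_id hom_comp[OF s'(1) fP])
  obtain F' :: "('a, 'a list) module" and f' where F': "F' \<in> fg_modules R" "hom_ext_vanish R N P ?K F'"
    "f' \<in> module_hom R F' P" "f' ` carrier F' = carrier P"
    using hom_ext_vanish_cover[OF R P(1)] by blast
  obtain t where t: "t \<in> module_hom R P F'" "\<And>x. x \<in> carrier P \<Longrightarrow> f' (t x) = x"
    using projective_section[OF P(2,1) F'(1,3,4)] by blast
  have "?e x = \<zero>\<^bsub>P\<^esub>" if "x \<in> carrier P" "p x = \<zero>\<^bsub>N\<^esub>" for x
    using that s(2)[of x] s'(2)[of x] by (simp add: kernel_iff P.M.diff_eq_zero_iff)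
  then obtain h where h: "h \<in> module_hom R N P" "\<And>x. x \<in> carrier P \<Longrightarrow> h (p x) = ?e x"
    using hom_factor[OF r r(1) p e] by blast
  have "p x = \<zero>\<^bsub>N\<^esub>" if x: "x \<in> carrier P" for x
  proof -
    have px: "p x \<in> carrier N" by (rule hom_closed[OF p(1) x])
    have "t (h (p x)) = \<zero>\<^bsub>F'\<^esub>"
      by (rule hom_ext_vanish_zero[OF F'(2) hom_comp[OF h(1) t(1)] px])
    then have "h (p x) = \<zero>\<^bsub>P\<^esub>"
      using t(2)[OF hom_closed[OF h(1) px]] hom_zero[OF fg_modules_right_module[OF F'(1)] r(1) F'(3)]
      by simp
    then have "x = f (s' x)"
      using h(2)[OF x] x hom_closed[OF fP hom_closed[OF s'(1) x]] by (simp add: P.M.diff_eq_zero_iff)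
    moreover have "f (s' x) \<in> carrier ?K" by (intro hom_closed[OF F(3)] hom_closed[OF s'(1) x])
    ultimately show ?thesis by (simp add: kernel_iff)
  qed
  then have "p ` carrier P \<subseteq> {\<zero>\<^bsub>N\<^esub>}" by auto
  then show ?thesis using p(2) N.M.zero_closed by auto
qed

text \<open>If \<open>Hom(N, I\<^sub>0) = Hom(N, I\<^sub>1) = 0\<close>, then \<open>Hom(N, R)\<close> and \<open>Ext\<^sup>1(N, R)\<close> vanish.  For the
  latter, a homomorphism \<open>K \<rightarrow> R\<close> extends to \<open>\<psi> : P \<rightarrow> I\<^sub>0\<close>; the composite \<open>P \<rightarrow> I\<^sub>0 \<rightarrow> I\<^sub>1\<close> kills \<open>K\<close>,
  so it factors through \<open>N\<close> and is zero, and \<open>\<psi>\<close> takes its values in \<open>R\<close>.\<close>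

lemma nonzero_hom_if_pd_le_one:
  fixes I0 I1 :: "('a, 'a list) module"
  assumes I0: "I0 \<in> fg_modules R" "injective_module R I0" and I1: "I1 \<in> fg_modules R"
    and j: "j \<in> module_hom R (regular_module R) I0" "inj_on j (carrier R)"
    and d: "d \<in> module_hom R I0 I1" and exact: "j ` carrier R = a_kernel I0 I1 d"
    and N: "N \<in> fg_modules R" "pd_le_one R N" "carrier N \<noteq> {\<zero>\<^bsub>N\<^esub>}"
  obtains I \<phi> x where "I = I0 \<or> I = I1" "\<phi> \<in> module_hom R N I" "x \<in> carrier N" "\<phi> x \<noteq> \<zero>\<^bsub>I\<^esub>"
proof (rule ccontr)
  assume "\<not> thesis"
  then have van0: "\<And>\<phi> x. \<phi> \<in> module_hom R N I0 \<Longrightarrow> x \<in> carrier N \<Longrightarrow> \<phi> x = \<zero>\<^bsub>I0\<^esub>"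
    and van1: "\<And>\<phi> x. \<phi> \<in> module_hom R N I1 \<Longrightarrow> x \<in> carrier N \<Longrightarrow> \<phi> x = \<zero>\<^bsub>I1\<^esub>"
    using that by blast+
  let ?R = "regular_module R"
  have [simp]: "carrier ?R = carrier R" by (simp add: regular_module_def)
  obtain P :: "('a, 'a list) module" and p where P: "P \<in> fg_modules R" "projective_module R P"
     and p: "p \<in> module_hom R P N" "p ` carrier P = carrier N"
     and K: "projective_module R (P\<lparr>carrier := a_kernel P N p\<rparr>)"
    using N(2) unfolding pd_le_one_def by blast
  let ?K = "P\<lparr>carrier := a_kernel P N p\<rparr>"
  have Kfg: "?K \<in> fg_modules R" by (rule fg_modules_kernel[OF P(1) N(1) p(1)])
  have r: "right_module R P" "right_module R N" "right_module R I0" "right_module R I1"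
    using P N I0 I1 by (auto intro: fg_modules_right_module)
  have rR: "right_module R ?R" by (rule right_module_regular[OF ring])
  let ?J = "I0\<lparr>carrier := j ` carrier R\<rparr>"
  have jsub: "submodule (j ` carrier R) R I0"
    using submodule_image[OF rR r(3) j(1) submodule_carrier[OF rR]] by simp
  have jJ: "j \<in> module_hom R ?R ?J" by (rule hom_corestrict[OF j(1)]) simp
  have "bij_betw j (carrier ?R) (carrier ?J)" using j(2) by (simp add: bij_betw_def)
  note k = hom_inv(1)[OF jJ this rR right_module_submodule[OF r(3) jsub]]
  have "hom_ext_vanish R N P ?K ?R"
    unfolding hom_ext_vanish_def
  proof (intro conjI ballI)
    fix \<phi> x assume \<phi>: "\<phi> \<in> module_hom R N ?R" and x: "x \<in> carrier N"
    have "j (\<phi> x) = \<zero>\<^bsub>I0\<^esub>" by (rule van0[OF hom_comp[OF \<phi> j(1)] x])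
    then show "\<phi> x = \<zero>\<^bsub>?R\<^esub>"
      using j(2) hom_inj_iff[OF rR r(3) j(1)] hom_closed[OF \<phi> x] by simp
  next
    fix \<phi> assume \<phi>: "\<phi> \<in> module_hom R ?K ?R"
    have "a_kernel P N p \<subseteq> carrier P" by (auto simp: kernel_iff)
    then obtain \<psi> where \<psi>: "\<psi> \<in> module_hom R P I0" "\<And>x. x \<in> carrier ?K \<Longrightarrow> \<psi> x = j (\<phi> x)"
      using injective_extend_submodule[OF I0(2) P(1) Kfg _ hom_comp[OF \<phi> j(1)]] by auto
    have "d (\<psi> x) = \<zero>\<^bsub>I1\<^esub>" if "x \<in> carrier P" "p x = \<zero>\<^bsub>N\<^esub>" for x
    proof -
      have x: "x \<in> carrier ?K" using that by (simp add: kernel_iff)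
      then have "\<psi> x \<in> j ` carrier R" using \<psi>(2) hom_closed[OF \<phi> x] by simp
      then show ?thesis unfolding exact by (simp add: kernel_iff)
    qed
    then obtain \<theta> where \<theta>: "\<theta> \<in> module_hom R N I1" "\<And>x. x \<in> carrier P \<Longrightarrow> \<theta> (p x) = d (\<psi> x)"
      using hom_factor[OF r(1,2,4) p hom_comp[OF \<psi>(1) d]] by blast
    have "\<psi> x \<in> j ` carrier R" if x: "x \<in> carrier P" for x
      using \<theta>(2)[OF x] van1[OF \<theta>(1) hom_closed[OF p(1) x]] hom_closed[OF \<psi>(1) x]
      unfolding exact by (simp add: kernel_iff)
    then have "\<psi> \<in> module_hom R P ?J" by (intro hom_corestrict[OF \<psi>(1)]) auto
    then have "(\<lambda>x. inv_into (carrier ?R) j (\<psi> x)) \<in> module_hom R P ?R" by (rule hom_comp[OF _ k])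
    moreover have "inv_into (carrier ?R) j (\<psi> x) = \<phi> x" if "x \<in> carrier ?K" for x
      using \<psi>(2)[OF that] j(2) hom_closed[OF \<phi> that] by simp
    ultimately show "\<exists>\<psi>\<in>module_hom R P ?R. \<forall>x\<in>carrier ?K. \<psi> x = \<phi> x"
      by (intro bexI[of _ "\<lambda>x. inv_into (carrier ?R) j (\<psi> x)"] ballI)
  qed
  then have "carrier N = {\<zero>\<^bsub>N\<^esub>}" by (rule trivial_if_hom_ext_vanish[OF N(1) P p K])
  then show False using N(3) by simp
qed

section \<open>Embedding a module into a projective module\<close>

text \<open>A homomorphism to a projective module with kernel of least rank is injective: otherwise its
  kernel contains a nonzero submodule \<open>N\<close> of the socle, and a homomorphism from \<open>M\<close> to \<open>I\<^sub>0\<close> or \<open>I\<^sub>1\<close>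
  that is not zero on \<open>N\<close>, added as a further component, cuts the kernel down.\<close>

lemma embeds_in_projective_if_socle_pd_le_one:
  fixes I0 I1 :: "('a, 'a list) module" and M :: "('a, 'm) module"
  assumes gl: "\<And>L :: ('a, 'a list) module. L \<in> fg_modules R \<Longrightarrow> pd_le_two R L"
    and I0: "I0 \<in> fg_modules R" "injective_module R I0" "projective_module R I0"
    and I1: "I1 \<in> fg_modules R" "injective_module R I1" "projective_module R I1"
    and j: "j \<in> module_hom R (regular_module R) I0" "inj_on j (carrier R)"
    and d: "d \<in> module_hom R I0 I1" and exact: "j ` carrier R = a_kernel I0 I1 d"
    and M: "M \<in> fg_modules R" and soc: "pd_le_one R (socle R M)"
  obtains Q :: "('a, 'a list) module" and f where "Q \<in> fg_modules R" "projective_module R Q"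
    "f \<in> module_hom R M Q" "inj_on f (carrier M)"
proof -
  have rM: "right_module R M" "finitely_generated R M" using M by (auto simp: fg_modules_def)
  interpret M: right_module R M by (rule rM)
  have len: "bounded_length R M" by (rule bounded_length_fg[OF rM length])
  then obtain \<rho> where \<rho>: "submodule_rank R M (carrier M) \<rho>" by (auto simp: bounded_length_def)
  have ess: "essential_submodule (carrier (socle R M)) R M" by (rule socle_essential[OF rM(1) len])
  then have S: "submodule (carrier (socle R M)) R M" by (simp add: essential_submodule_def)
  have socM: "socle R M = M\<lparr>carrier := carrier (socle R M)\<rparr>" by (simp add: socle_def)
  have socfg: "socle R M \<in> fg_modules R" by (subst socM) (rule fg_modules_submodule[OF M S])
  let ?A = "\<lambda>(Q :: ('a, 'a list) module, f). Q \<in> fg_modules R \<and> projective_module R Q \<and> f \<in> module_hom R M Q"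
  have "?A (I0, \<lambda>_. \<zero>\<^bsub>I0\<^esub>)"
  proof -
    interpret I0: right_module R I0 using I0(1) by (rule fg_modules_right_module)
    show ?thesis using I0 by (auto intro!: module_homI simp: I0.smult_zero)
  qed
  from ex_has_least_nat[of ?A, OF this, of "\<lambda>(Q, f). \<rho> (a_kernel M Q f)"]
  obtain Q :: "('a, 'a list) module" and f where Q: "Q \<in> fg_modules R" "projective_module R Q"
    and f: "f \<in> module_hom R M Q"
    and min: "\<And>(Q' :: ('a, 'a list) module) f'. Q' \<in> fg_modules R \<Longrightarrow> projective_module R Q' \<Longrightarrow>
      f' \<in> module_hom R M Q' \<Longrightarrow> \<rho> (a_kernel M Q f) \<le> \<rho> (a_kernel M Q' f')"
    by auto
  have rQ: "right_module R Q" using Q by (intro fg_modules_right_module)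
  have kerf: "submodule (a_kernel M Q f) R M" by (rule submodule_kernel[OF rM(1) rQ f])
  have "a_kernel M Q f = {\<zero>\<^bsub>M\<^esub>}"
  proof (rule ccontr)
    assume "a_kernel M Q f \<noteq> {\<zero>\<^bsub>M\<^esub>}"
    let ?V = "a_kernel M Q f \<inter> carrier (socle R M)"
    have V: "?V \<noteq> {\<zero>\<^bsub>M\<^esub>}" using ess kerf \<open>a_kernel M Q f \<noteq> {\<zero>\<^bsub>M\<^esub>}\<close>
      unfolding essential_submodule_def by blast
    have Vsub: "submodule ?V R M" by (rule submodule_Int[OF rM(1) kerf S])
    let ?N = "M\<lparr>carrier := ?V\<rparr>"
    have "submodule ?V R (socle R M)"
      by (subst socM) (use Vsub in \<open>simp add: submodule_submodule_iff[OF rM(1) S]\<close>)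
    from submodule_pd_le_one[OF gl socfg soc this]
    have pdN: "pd_le_one R ?N" by (simp add: socle_def)
    have Nfg: "?N \<in> fg_modules R" by (rule fg_modules_submodule[OF M Vsub])
    have Nne: "carrier ?N \<noteq> {\<zero>\<^bsub>?N\<^esub>}" using V by simp
    obtain I \<phi> x where I: "I = I0 \<or> I = I1" and \<phi>: "\<phi> \<in> module_hom R ?N I"
      and x: "x \<in> carrier ?N" "\<phi> x \<noteq> \<zero>\<^bsub>I\<^esub>"
      using nonzero_hom_if_pd_le_one[OF I0(1,2) I1(1) j d exact Nfg pdN Nne] by blast
    have I': "I \<in> fg_modules R" "injective_module R I" "projective_module R I"
      using I I0 I1 by auto
    have "?V \<subseteq> carrier M" by (auto simp: kernel_iff)
    then obtain g where g: "g \<in> module_hom R M I" "\<And>x. x \<in> carrier ?N \<Longrightarrow> g x = \<phi> x"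
      using injective_extend_submodule[OF I'(2) M Nfg _ \<phi>] by auto
    obtain H :: "('a, 'a list) module" and i1 i2 q1 q2 where H: "biproduct R Q I H i1 i2 q1 q2"
      using biproduct_exists[OF Q(1) I'(1)] by blast
    have i: "i1 \<in> module_hom R Q H" "i2 \<in> module_hom R I H" and HH: "H \<in> fg_modules R"
      using H by (auto simp: biproduct_def)
    have rH: "right_module R H" "right_module R I"
      using HH I' by (auto intro: fg_modules_right_module)
    have q: "q1 \<in> module_hom R H Q" "q2 \<in> module_hom R H I" using H by (auto simp: biproduct_def)
    let ?h = "\<lambda>y. i1 (f y) \<oplus>\<^bsub>H\<^esub> i2 (g y)"
    have h: "?h \<in> module_hom R M H" by (intro hom_plus[OF rH(1)] hom_comp[OF f i(1)] hom_comp[OF g(1) i(2)])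
    have fg0: "f y = \<zero>\<^bsub>Q\<^esub> \<and> g y = \<zero>\<^bsub>I\<^esub>" if "y \<in> a_kernel M H ?h" for y
    proof -
      have y: "y \<in> carrier M" "?h y = \<zero>\<^bsub>H\<^esub>" using that by (auto simp: kernel_iff)
      note c = biproduct_combine[OF H rQ rH(2) hom_closed[OF f y(1)] hom_closed[OF g(1) y(1)]]
      show ?thesis
        using c(2,3) hom_zero[OF rH(1) rQ q(1)] hom_zero[OF rH(1,2) q(2)] unfolding y(2) by simp
    qed
    have "x \<in> a_kernel M Q f" using x by simp
    moreover have "x \<notin> a_kernel M H ?h" using fg0[of x] g(2)[OF x(1)] x(2) by auto
    moreover have "a_kernel M H ?h \<subseteq> a_kernel M Q f" using fg0 by (auto simp: kernel_iff)
    ultimately have "a_kernel M H ?h \<subset> a_kernel M Q f" by auto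
    then have "\<rho> (a_kernel M H ?h) < \<rho> (a_kernel M Q f)"
      using \<rho> submodule_kernel[OF rM(1) rH(1) h] kerf unfolding submodule_rank_def
      by (auto simp: submodule_iff[OF rM(1)])
    then show False using min[OF HH projective_biproduct[OF Q(2) I'(3) H] h] by simp
  qed
  then have "inj_on f (carrier M)"
    using hom_inj_iff[OF rM(1) rQ f] by (auto simp: kernel_iff set_eq_iff)
  then show thesis by (rule that[OF Q f])
qed

lemma pd_le_one_if_embeds_in_projective:
  fixes Q :: "('a, 'a list) module"
  assumes gl: "\<And>L :: ('a, 'a list) module. L \<in> fg_modules R \<Longrightarrow> pd_le_two R L"
    and M: "M \<in> fg_modules R" and Q: "Q \<in> fg_modules R" "projective_module R Q"
    and f: "f \<in> module_hom R M Q" "inj_on f (carrier M)"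
  shows "pd_le_one R M"
proof -
  have r: "right_module R M" "right_module R Q" using M Q by (auto intro: fg_modules_right_module)
  let ?J = "Q\<lparr>carrier := f ` carrier M\<rparr>"
  have J: "submodule (f ` carrier M) R Q" by (rule submodule_image[OF r f(1) submodule_carrier[OF r(1)]])
  have pdJ: "pd_le_one R ?J" by (rule submodule_pd_le_one[OF gl Q(1) pd_le_one_projective[OF Q] J])
  have rJ: "right_module R ?J" by (rule right_module_submodule[OF r(2) J])
  have fJ: "f \<in> module_hom R M ?J" by (rule hom_corestrict[OF f(1)]) simp
  have "bij_betw f (carrier M) (carrier ?J)" using f(2) by (simp add: bij_betw_def)
  note inv = hom_inv[OF fJ this r(1) rJ]
  show ?thesis by (rule pd_le_one_iso[OF r(1) rJ inv pdJ])
qed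

end

lemma dominant_dimension_ge_two:
  assumes "dominant_dimension R \<ge> 2"
  obtains j I d where "minimal_injective_resolution R (regular_module R) j I d"
    "projective_module R (I 0)" "projective_module R (I 1)"
proof -
  let ?Q = "\<lambda>n. \<exists>j I d. minimal_injective_resolution R (regular_module R) j I d \<and>
             (\<forall>i<n. projective_module R (I i))"
  have "\<exists>n\<ge>2. ?Q n"
  proof (rule ccontr)
    assume *: "\<not> ?thesis"
    have "Sup {enat n | n. ?Q n} \<le> enat 1"
    proof (rule Sup_least)
      fix x assume "x \<in> {enat n | n. ?Q n}"
      then obtain n where "x = enat n" "?Q n" by blast
      then show "x \<le> enat 1" using * by (cases "n \<ge> 2") auto
    qed
    then have "dominant_dimension R \<le> enat 1" unfolding dominant_dimension_def .
    then have "enat 2 \<le> enat 1" using assms by (metis numeral_eq_enat order_trans)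
    then show False by simp
  qed
  then show thesis using that by (metis less_le_trans one_less_numeral_iff semiring_norm(76) zero_less_numeral)
qed

theorem theoremB:
  fixes K :: "('k, 'x) ring_scheme" and \<Lambda> :: "('k, 'a) module"
  assumes "algebraically_closed K"
    and "finite_dimensional_algebra K \<Lambda>"
    and "basic_algebra \<Lambda>"
    and "auslander_algebra \<Lambda>"
  shows "(\<forall>M \<in> (fg_modules \<Lambda> :: ('a, 'm) module set).
            projective_dimension \<Lambda> M \<le> 1 \<longleftrightarrow> projective_dimension \<Lambda> (socle \<Lambda> M) \<le> 1) \<and>
         (modules_pd_le 1 \<Lambda> :: ('a, 'm) module set) =
            {M \<in> fg_modules \<Lambda>. projective_dimension \<Lambda> (socle \<Lambda> M) \<le> 1}"
proof -
  interpret finite_length_ring \<Lambda>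
    using assms(2)
    by (intro finite_length_ring.intro bounded_length_algebra)
      (auto simp: finite_dimensional_algebra_def intro: field_algebra.ring)
  have gl: "pd_le_two \<Lambda> L" if L: "L \<in> fg_modules \<Lambda>" for L :: "('a, 'a list) module"
  proof (rule pd_le_two_if_projective_dimension_le_two[OF L])
    have "projective_dimension \<Lambda> L \<le> global_dimension \<Lambda>"
      unfolding global_dimension_def by (rule SUP_upper[OF L])
    also have "\<dots> \<le> 2" using assms(4) by (simp add: auslander_algebra_def)
    finally show "projective_dimension \<Lambda> L \<le> 2" .
  qed
  have "dominant_dimension \<Lambda> \<ge> 2" using assms(4) by (simp add: auslander_algebra_def)
  then obtain j I d where res: "minimal_injective_resolution \<Lambda> (regular_module \<Lambda>) j I d"
    and proj: "projective_module \<Lambda> (I 0)" "projective_module \<Lambda> (I 1)"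
    by (rule dominant_dimension_ge_two)
  have I: "\<And>i. I i \<in> fg_modules \<Lambda>" "\<And>i. injective_module \<Lambda> (I i)"
    and j: "j \<in> module_hom \<Lambda> (regular_module \<Lambda>) (I 0)" "inj_on j (carrier \<Lambda>)"
    and d: "d 0 \<in> module_hom \<Lambda> (I 0) (I 1)" and exact: "j ` carrier \<Lambda> = a_kernel (I 0) (I 1) (d 0)"
    using res by (auto simp: minimal_injective_resolution_def regular_module_def)
  have *: "projective_dimension \<Lambda> M \<le> 1 \<longleftrightarrow> projective_dimension \<Lambda> (socle \<Lambda> M) \<le> 1"
    if M: "M \<in> fg_modules \<Lambda>" for M :: "('a, 'm) module"
  proof -
    have rM: "right_module \<Lambda> M" "finitely_generated \<Lambda> M" using M by (auto simp: fg_modules_def)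
    have "essential_submodule (carrier (socle \<Lambda> M)) \<Lambda> M"
      by (rule socle_essential[OF rM(1) bounded_length_fg[OF rM length]])
    then have S: "submodule (carrier (socle \<Lambda> M)) \<Lambda> M" by (simp add: essential_submodule_def)
    have socM: "M\<lparr>carrier := carrier (socle \<Lambda> M)\<rparr> = socle \<Lambda> M" by (simp add: socle_def)
    have "pd_le_one \<Lambda> M \<longleftrightarrow> pd_le_one \<Lambda> (socle \<Lambda> M)"
    proof
      assume "pd_le_one \<Lambda> M"
      then show "pd_le_one \<Lambda> (socle \<Lambda> M)"
        using submodule_pd_le_one[OF gl M _ S] unfolding socM by blast
    next
      assume "pd_le_one \<Lambda> (socle \<Lambda> M)"
      then obtain Q :: "('a, 'a list) module" and f where Q: "Q \<in> fg_modules \<Lambda>" "projective_module \<Lambda> Q"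
        and f: "f \<in> module_hom \<Lambda> M Q" "inj_on f (carrier M)"
        using embeds_in_projective_if_socle_pd_le_one[OF gl I proj(1) I proj(2) j d exact M] by blast
      show "pd_le_one \<Lambda> M" by (rule pd_le_one_if_embeds_in_projective[OF gl M Q f])
    qed
    then show ?thesis
      using projective_dimension_le_one_iff[OF M] projective_dimension_le_one_iff[OF fg_modules_submodule[OF M S]] unfolding socM by blast
  qed
  then show ?thesis by (auto simp: modules_pd_le_def one_enat_def)
qed

end
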